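(* Let $G$ be a finite group (written multiplicatively) and let $S\subseteq G$ be a subset for which there exists a subset $T\subseteq G$ such that $2\le |T|$ and $|TS|\le \min(|G|-2,\ |T|+|S|-1)$. Then at least one of the following holds: (i) $S$ is a geometric progression, i.e. there exist $g,a\in G$ such that one of the two sets $gS$, $Sg$ equals $\{1,a,a^2,\ldots,a^{|S|-1}\}$; (ii) there exist a non-trivial proper subgroup $H$ of $G$ and $\varepsilon\in\{1,-1\}$ such that $|HS^{\varepsilon}|\le |H|+|S|-1$; (iii) there exist a subgroup $H$ of $G$, an element $a\in G$ and $\varepsilon\in\{1,-1\}$ such that $|HaH|=|H|^2$ and, letting $A=H\cup Ha$, $$|AS^{\varepsilon}|=|A|+|S|-1=|G|-|A|.$$
   Context: For subsets $X,Y$ of a group, $XY=\{xy: x\in X, y\in Y\}$. $S^{1}=S$ and $S^{-1}=\{s^{-1}: s\in S\}$. *)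

theory Defs
  imports "HOL-Algebra.Algebra"
begin

(* The index range i < card S makes the empty set a (degenerate) geometric progression. *)
definition geometric_progression :: "('a, 'b) monoid_scheme \<Rightarrow> 'a set \<Rightarrow> bool" where
  "geometric_progression G S \<longleftrightarrow>
     (\<exists>g \<in> carrier G. \<exists>a \<in> carrier G.
        g <#\<^bsub>G\<^esub> S = {a [^]\<^bsub>G\<^esub> i | i::nat. i < card S} \<or>
        S #>\<^bsub>G\<^esub> g = {a [^]\<^bsub>G\<^esub> i | i::nat. i < card S})"

definition set_sign_pow :: "('a, 'b) monoid_scheme \<Rightarrow> 'a set \<Rightarrow> int \<Rightarrow> 'a set" where
  "set_sign_pow G S e = (if e = -1 then set_inv\<^bsub>G\<^esub> S else S)"

end

theory Submission
  imports Defs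
begin

text \<open>
The proof is isoperimetric. Among the sets \<open>V\<close> with \<open>card V \<ge> 2\<close> and \<open>card (VS) \<le> |G| - 2\<close>,
let \<open>k\<close> be the least value of \<open>card (VS) - card V\<close>; the hypothesis on \<open>T\<close> says that
\<open>k \<le> card S - 1\<close>. The minimisers are called fragments. Taking \<open>V\<close> to the complement of \<open>VS\<close> is
a bijection between the fragments of \<open>S\<close> and those of \<open>S\<inverse>\<close> (lemma \<open>fragment_cofragment\<close>), so \<open>S\<close> and \<open>S\<inverse>\<close> have
the same \<open>k\<close> and may be exchanged. Let \<open>\<alpha>\<close> be the least size of a fragment of either set, and
let \<open>A\<close> be a fragment of \<open>S\<close> of size \<open>\<alpha>\<close>, an atom; its left translates are atoms as well.

Since \<open>V \<mapsto> card (VS)\<close> is submodular, an atom that meets a fragment in at least two points lies in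
it. So two distinct translates of \<open>A\<close> share at most one point. Moreover a single point satisfies
\<open>card (VS) - card V \<ge> k\<close> too, because \<open>k < card S\<close>; hence an atom that meets a fragment \<open>F\<close> in
exactly one point can be adjoined to \<open>F\<close>, giving a larger fragment, as long as
\<open>card F + \<alpha> + k < |G|\<close>. Four situations arise.

\<^item> If \<open>A\<close> meets no other translate of itself, it is a left coset of a subgroup, and this subgroup has
  a small product with \<open>S\<close>. The same applies to an atom of \<open>S\<inverse>\<close>. In what follows this does not
  occur, so every point lies on two translates of each atom.
\<^item> If \<open>\<alpha> = 2\<close>, then up to translation \<open>A = {1, a}\<close>, so at most one point of \<open>aS\<close> is outside \<open>S\<close>.
  Then \<open>S\<close> is a progression, or the cyclic subgroup generated by \<open>a\<close> has a small product with \<open>S\<close>.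
\<^item> If \<open>\<alpha> \<ge> 3\<close> and \<open>|G| = 2\<alpha> + k\<close>, the complements of \<open>BS\<close>, for the translates \<open>B\<close> of \<open>A\<close> through
  a point \<open>z\<close>, are atoms of \<open>S\<inverse>\<close> inside the complement of \<open>zS\<close>, a set with only \<open>2\<alpha> - 1\<close> elements.
  Two of them already cover it, so there is no third, and \<open>A\<close> consists of two cosets of its
  stabiliser. This is the exceptional structure.
\<^item> If \<open>\<alpha> \<ge> 3\<close> and \<open>|G| > 2\<alpha> + k\<close>, atoms are adjoined one after another, each through a new point of
  the previous one, until a fragment \<open>F\<close> with \<open>card F + \<alpha> + k = |G|\<close> is reached. This path of atoms
  has at most two ends. On the other hand, the complement \<open>D\<close> of \<open>FS\<close> is an atom of \<open>S\<inverse>\<close>; for each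
  \<open>d \<in> D\<close> there is a translate \<open>gD\<close> meeting \<open>D\<close> in \<open>d\<close> alone, and then \<open>F - gF\<close> is an atom of \<open>F\<close>
  without its attaching point. This yields \<open>\<alpha> \<ge> 3\<close> different ends, a contradiction.
\<close>

(* The symbol denotes left cosets throughout, never the strict order on multisets. *)
no_notation subset_mset (infix \<open><#\<close> 50)

section \<open>Translates and product sets\<close>

lemma singleton_if_card_less_two:
  assumes "finite V" "z \<in> V" "\<not> 2 \<le> card V"
  shows "V = {z}"
proof -
  have "card {z} \<le> card V" using assms(1,2) by (intro card_mono) auto
  then have "card V = card {z}" using assms(3) by simp
  then show ?thesis using card_subset_eq[of V "{z}"] assms(1,2) by simp
qed

context group
begin

lemma l_coset_eq_image: "g <# V = (\<lambda>x. g \<otimes> x) ` V"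
  by (auto simp: l_coset_def)

lemma card_l_coset:
  assumes "g \<in> carrier G" "V \<subseteq> carrier G"
  shows "card (g <# V) = card V"
proof -
  have "inj_on ((\<otimes>) g) V"
  proof (rule inj_onI)
    fix x y assume "x \<in> V" "y \<in> V" "g \<otimes> x = g \<otimes> y"
    then show "x = y" using assms l_cancel[of g x y] by blast
  qed
  then show ?thesis unfolding l_coset_eq_image by (rule card_image)
qed

lemma inv_cancel_left:
  assumes "x \<in> carrier G" "y \<in> carrier G"
  shows "inv x \<otimes> (x \<otimes> y) = y" "x \<otimes> (inv x \<otimes> y) = y"
  using m_assoc[of "inv x" x y] m_assoc[of x "inv x" y] assms by simp_all

lemma mem_l_coset_iff:
  assumes "g \<in> carrier G" "V \<subseteq> carrier G" "x \<in> carrier G"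
  shows "x \<in> g <# V \<longleftrightarrow> inv g \<otimes> x \<in> V"
proof
  assume "x \<in> g <# V"
  then obtain v where v: "v \<in> V" "x = g \<otimes> v" unfolding l_coset_eq_image by blast
  then have "inv g \<otimes> x = v" using inv_cancel_left(1)[OF assms(1)] assms(2) by blast
  then show "inv g \<otimes> x \<in> V" using v by simp
next
  assume "inv g \<otimes> x \<in> V"
  then have "g \<otimes> (inv g \<otimes> x) \<in> g <# V" unfolding l_coset_eq_image by (rule imageI)
  then show "x \<in> g <# V" unfolding inv_cancel_left(2)[OF assms(1,3)] .
qed

lemma l_coset_cancel:
  assumes "g \<in> carrier G" "V \<subseteq> carrier G"
  shows "inv g <# (g <# V) = V" "g <# (inv g <# V) = V"
  using lcos_m_assoc[OF assms(2), of "inv g" g] lcos_m_assoc[OF assms(2), of g "inv g"]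
    lcos_mult_one[OF assms(2)] assms(1) by simp_all

lemma l_coset_Diff:
  assumes "g \<in> carrier G" "V \<subseteq> carrier G"
  shows "carrier G - (g <# V) = g <# (carrier G - V)"
proof (rule Set.set_eqI)
  fix x
  show "x \<in> carrier G - (g <# V) \<longleftrightarrow> x \<in> g <# (carrier G - V)"
  proof (cases "x \<in> carrier G")
    case True
    then show ?thesis using assms by (simp add: mem_l_coset_iff)
  next
    case False
    moreover have "g <# (carrier G - V) \<subseteq> carrier G"
      using assms(1) by (intro l_coset_subset_G) auto
    ultimately show ?thesis by blast
  qed
qed

lemma set_mult_Un_left: "(V \<union> Y) <#> Z = (V <#> Z) \<union> (Y <#> Z)"
  by (auto simp: set_mult_def)

lemma set_inv_subset: "V \<subseteq> carrier G \<Longrightarrow> set_inv V \<subseteq> carrier G"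
  by (auto simp: SET_INV_def)

lemma set_inv_set_inv: "V \<subseteq> carrier G \<Longrightarrow> set_inv (set_inv V) = V"
  by (force simp: SET_INV_def)

lemma card_set_inv: "V \<subseteq> carrier G \<Longrightarrow> card (set_inv V) = card V"
proof -
  assume V: "V \<subseteq> carrier G"
  have "set_inv V = m_inv G ` V" by (auto simp: SET_INV_def)
  moreover have "inj_on (m_inv G) V" using inv_inj V by (rule inj_on_subset)
  ultimately show ?thesis by (simp add: card_image)
qed

text \<open>The adjunction behind the duality between \<open>S\<close> and its inverse set: a point of \<open>Y\<close> lies in the product
set \<open>VS\<close> exactly when \<open>V\<close> meets the product of \<open>Y\<close> with the inverses of \<open>S\<close>.\<close>

lemma set_mult_disjoint_iff:
  assumes "V \<subseteq> carrier G" "Y \<subseteq> carrier G" "S \<subseteq> carrier G"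
  shows "(V <#> S) \<inter> Y = {} \<longleftrightarrow> V \<inter> (Y <#> set_inv S) = {}"
proof -
  have *: "y = x \<otimes> s \<longleftrightarrow> x = y \<otimes> inv s" if "x \<in> V" "y \<in> Y" "s \<in> S" for x y s
    using that assms by (metis inv_solve_right subsetD)
  have "(V <#> S) \<inter> Y \<noteq> {} \<longleftrightarrow> (\<exists>x\<in>V. \<exists>y\<in>Y. \<exists>s\<in>S. y = x \<otimes> s)"
    by (auto simp: set_mult_def)
  also have "\<dots> \<longleftrightarrow> (\<exists>x\<in>V. \<exists>y\<in>Y. \<exists>s\<in>S. x = y \<otimes> inv s)"
    using * by blast
  also have "\<dots> \<longleftrightarrow> V \<inter> (Y <#> set_inv S) \<noteq> {}"
    by (auto simp: set_mult_def SET_INV_def)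
  finally show ?thesis by blast
qed

end

section \<open>Fragments and duality\<close>

text \<open>A fragment of \<open>S\<close> for the constant \<open>k\<close> is an admissible set \<open>V\<close> (at least two elements, at least two
elements outside \<open>VS\<close>) at which \<open>card (VS) - card V\<close> equals \<open>k\<close>. That \<open>k\<close> is the least such value is
assumed separately, in the locale below.\<close>

definition fragment :: "('a, 'b) monoid_scheme \<Rightarrow> 'a set \<Rightarrow> nat \<Rightarrow> 'a set \<Rightarrow> bool" where
  "fragment G S k V \<longleftrightarrow>
     V \<subseteq> carrier G \<and> 2 \<le> card V \<and> card (V <#>\<^bsub>G\<^esub> S) + 2 \<le> order G
     \<and> card (V <#>\<^bsub>G\<^esub> S) = card V + k"

text \<open>The complement of \<open>VS\<close>, which is the dual of \<open>V\<close> when \<open>V\<close> is a fragment.\<close>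

definition cofragment :: "('a, 'b) monoid_scheme \<Rightarrow> 'a set \<Rightarrow> 'a set \<Rightarrow> 'a set" where
  "cofragment G S V = carrier G - (V <#>\<^bsub>G\<^esub> S)"

text \<open>The constant \<open>k\<close> bounds \<open>card (VS) - card V\<close> from below on admissible sets and is smaller than
\<open>card S\<close>. Whether \<open>k\<close> is attained is left open.\<close>

locale isoperimetric = group G for G (structure) +
  fixes S :: "'a set" and k :: nat
  assumes finite_carrier: "finite (carrier G)"
    and S_subset: "S \<subseteq> carrier G"
    and k_less: "k < card S"
    and expansion: "\<And>V. \<lbrakk>V \<subseteq> carrier G; 2 \<le> card V; card (V <#> S) + 2 \<le> order G\<rbrakk>
                      \<Longrightarrow> card V + k \<le> card (V <#> S)"
begin

lemma finite_sub: "V \<subseteq> carrier G \<Longrightarrow> finite V"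
  using finite_carrier finite_subset by blast

lemma mult_subset: "V \<subseteq> carrier G \<Longrightarrow> V <#> S \<subseteq> carrier G"
  using S_subset by (rule set_mult_closed[rotated])

text \<open>Singletons obey the bound as well, because \<open>k < card S\<close>. This is what lets atoms be joined at a
single common point.\<close>

lemma expansion_nonempty:
  assumes "V \<subseteq> carrier G" "V \<noteq> {}" "card (V <#> S) + 2 \<le> order G"
  shows "card V + k \<le> card (V <#> S)"
proof (cases "card V = 1")
  case True
  then obtain x where "V = {x}" by (auto simp: card_1_singleton_iff)
  then have "card (V <#> S) = card S"
    using assms S_subset by (simp add: l_coset_eq_set_mult[symmetric] card_l_coset)
  then show ?thesis using True k_less by simp
next
  case False
  moreover have "card V \<noteq> 0" using assms finite_sub by auto
  ultimately show ?thesis using expansion assms by simp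
qed

lemma card_cofragment:
  "V \<subseteq> carrier G \<Longrightarrow> card (cofragment G S V) + card (V <#> S) = order G"
  using mult_subset[of V] finite_carrier
  by (simp add: cofragment_def order_def card_Diff_subset card_mono finite_sub)

lemma cofragment_subset: "cofragment G S V \<subseteq> carrier G"
  by (auto simp: cofragment_def)

lemma cofragment_mult:
  assumes "V \<subseteq> carrier G"
  shows "cofragment G S V <#> set_inv S \<subseteq> carrier G - V"
proof -
  have "(V <#> S) \<inter> cofragment G S V = {}" by (auto simp: cofragment_def)
  then have "V \<inter> (cofragment G S V <#> set_inv S) = {}"
    using set_mult_disjoint_iff assms cofragment_subset S_subset by blast
  moreover have "cofragment G S V <#> set_inv S \<subseteq> carrier G"
    using set_mult_closed cofragment_subset set_inv_subset S_subset by blast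
  ultimately show ?thesis by blast
qed

lemma card_compl: "V \<subseteq> carrier G \<Longrightarrow> card (carrier G - V) + card V = order G"
  using finite_carrier by (simp add: order_def card_Diff_subset card_mono finite_sub)

end

lemma (in isoperimetric) dual: "isoperimetric G (set_inv S) k"
proof
  show "finite (carrier G)" by (rule finite_carrier)
  show "set_inv S \<subseteq> carrier G" using set_inv_subset S_subset .
  show "k < card (set_inv S)" using k_less card_set_inv S_subset by simp
  fix Y assume Y: "Y \<subseteq> carrier G" "2 \<le> card Y" "card (Y <#> set_inv S) + 2 \<le> order G"
  \<comment> \<open>The bound for \<open>S\<close> is applied to the set of points whose products with \<open>S\<close> avoid \<open>Y\<close>.\<close>
  let ?V = "carrier G - (Y <#> set_inv S)"
  have sub: "Y <#> set_inv S \<subseteq> carrier G"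
    using Y set_mult_closed set_inv_subset S_subset by blast
  have V: "card ?V + card (Y <#> set_inv S) = order G"
    using card_compl[OF sub] .
  have "?V \<inter> (Y <#> set_inv S) = {}" by blast
  then have "(?V <#> S) \<inter> Y = {}"
    using set_mult_disjoint_iff[of ?V Y S] Y S_subset by blast
  moreover have "?V <#> S \<subseteq> carrier G" by (rule mult_subset) auto
  ultimately have "?V <#> S \<subseteq> carrier G - Y" by blast
  then have "card (?V <#> S) \<le> card (carrier G - Y)"
    using finite_carrier by (intro card_mono) auto
  moreover note card_compl[OF Y(1)]
  ultimately have le: "card (?V <#> S) + card Y \<le> order G" by linarith
  have "card ?V + k \<le> card (?V <#> S)"
    by (rule expansion) (use V Y le in auto)
  then show "card Y + k \<le> card (Y <#> set_inv S)" using le V by linarith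
qed

context isoperimetric
begin

lemma fragment_cofragment:
  assumes "fragment G S k V"
  shows "fragment G (set_inv S) k (cofragment G S V)"
    and "cofragment G (set_inv S) (cofragment G S V) = V"
    and "card (cofragment G S V) + card V + k = order G"
proof -
  interpret dual: isoperimetric G "set_inv S" k by (rule dual)
  let ?D = "cofragment G S V"
  have V: "V \<subseteq> carrier G" "2 \<le> card V" "card (V <#> S) + 2 \<le> order G"
    "card (V <#> S) = card V + k" using assms by (auto simp: fragment_def)
  show c: "card ?D + card V + k = order G"
    using card_cofragment[OF V(1)] V by simp
  have sub: "?D <#> set_inv S \<subseteq> carrier G - V" using cofragment_mult V by blast
  then have le: "card (?D <#> set_inv S) \<le> card (carrier G - V)"
    using finite_carrier by (intro card_mono) auto
  note cX = card_compl[OF V(1)]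
  have "card ?D + k \<le> card (?D <#> set_inv S)"
    by (rule dual.expansion) (use cofragment_subset le cX c V in auto)
  then have eq: "card (?D <#> set_inv S) = card ?D + k" "card (?D <#> set_inv S) = card (carrier G - V)"
    using le c cX by linarith+
  then show "fragment G (set_inv S) k ?D"
    unfolding fragment_def using cofragment_subset c cX V by auto
  have "?D <#> set_inv S = carrier G - V"
    using card_subset_eq[OF _ sub] eq finite_carrier by auto
  then show "cofragment G (set_inv S) ?D = V"
    unfolding cofragment_def using V by auto
qed

lemma fragment_l_coset:
  assumes "fragment G S k V" "g \<in> carrier G"
  shows "fragment G S k (g <# V)"
  using assms S_subset mult_subset l_coset_subset_G
  by (auto simp: fragment_def setmult_lcos_assoc card_l_coset)

lemma cofragment_l_coset:
  assumes "V \<subseteq> carrier G" "g \<in> carrier G"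
  shows "cofragment G S (g <# V) = g <# cofragment G S V"
  using assms S_subset mult_subset
  by (auto simp: cofragment_def setmult_lcos_assoc l_coset_Diff)

lemma submodular:
  assumes "V \<subseteq> carrier G" "Y \<subseteq> carrier G"
  shows "card ((V \<inter> Y) <#> S) + card ((V \<union> Y) <#> S) \<le> card (V <#> S) + card (Y <#> S)"
proof -
  have "(V \<inter> Y) <#> S \<subseteq> (V <#> S) \<inter> (Y <#> S)" by (auto simp: set_mult_def)
  then have "card ((V \<inter> Y) <#> S) \<le> card ((V <#> S) \<inter> (Y <#> S))"
    using assms mult_subset finite_sub by (intro card_mono) auto
  moreover have "card (V <#> S) + card (Y <#> S) = card ((V <#> S) \<union> (Y <#> S)) + card ((V <#> S) \<inter> (Y <#> S))"
    using assms mult_subset finite_sub by (intro card_Un_Int) auto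
  ultimately show ?thesis by (simp add: set_mult_Un_left)
qed

end

section \<open>Atoms and their translates\<close>

text \<open>The left translates of \<open>A\<close>, the blocks of a geometry on \<open>G\<close> on which \<open>G\<close> acts.\<close>

definition translates :: "('a, 'b) monoid_scheme \<Rightarrow> 'a set \<Rightarrow> 'a set set" where
  "translates G A = (\<lambda>g. g <#\<^bsub>G\<^esub> A) ` carrier G"

context group
begin

lemma translate_self: "A \<subseteq> carrier G \<Longrightarrow> A \<in> translates G A"
  by (metis image_eqI lcos_mult_one one_closed translates_def)

lemma translate_translate:
  assumes "A \<subseteq> carrier G" "B \<in> translates G A" "h \<in> carrier G"
  shows "h <# B \<in> translates G A"
  using assms by (auto simp: translates_def lcos_m_assoc)

lemma other_translate_through_point:
  assumes A: "A \<subseteq> carrier G" and B: "B \<in> translates G A" "B \<inter> A \<noteq> {}" "B \<noteq> A"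
    and z: "z \<in> carrier G"
  shows "\<exists>D \<in> translates G A. z \<in> D \<and> D \<noteq> C"
proof -
  obtain g where g: "g \<in> carrier G" "B = g <# A" using B by (auto simp: translates_def)
  \<comment> \<open>Moving a common point of \<open>A\<close> and \<open>B\<close> to \<open>z\<close> gives two distinct translates through \<open>z\<close>.\<close>
  obtain p where p: "p \<in> A" "p \<in> B" using B by blast
  have pc: "p \<in> carrier G" using p A by blast
  have Bsub: "B \<subseteq> carrier G" using g A l_coset_subset_G by simp
  let ?h = "z \<otimes> inv p"
  have h: "?h \<in> carrier G" using z pc by simp
  have "inv ?h \<otimes> z = p" using z pc by (simp add: inv_mult_group m_assoc)
  then have zin: "z \<in> ?h <# A" "z \<in> ?h <# B"
    using mem_l_coset_iff[OF h A z] mem_l_coset_iff[OF h Bsub z] p by simp_all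
  have "?h <# A \<noteq> ?h <# B"
    using l_coset_cancel(1)[OF h A] l_coset_cancel(1)[OF h Bsub] B(3) by metis
  moreover have "?h <# A \<in> translates G A" "?h <# B \<in> translates G A"
    using translate_translate[OF A _ h] translate_self[OF A] B by auto
  ultimately show ?thesis using zin by metis
qed

text \<open>A set whose distinct translates are pairwise disjoint is a left coset of a subgroup.\<close>

lemma coset_if_translates_disjoint:
  assumes A: "A \<subseteq> carrier G" "x \<in> A"
    and cl: "\<And>B. B \<in> translates G A \<Longrightarrow> B \<inter> A \<noteq> {} \<Longrightarrow> B = A"
  shows "subgroup (inv x <# A) G"
proof -
  let ?K = "inv x <# A"
  have x: "x \<in> carrier G" using A by blast
  have K: "?K \<subseteq> carrier G" using A x l_coset_subset_G by simp
  have one: "\<one> \<in> ?K" using A x by (simp add: mem_l_coset_iff)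
  have clK: "g <# ?K = ?K" if g: "g \<in> carrier G" "(g <# ?K) \<inter> ?K \<noteq> {}" for g
  proof -
    have "x <# (g <# ?K) = (x \<otimes> g \<otimes> inv x) <# A"
      using A x g K by (simp add: lcos_m_assoc m_assoc)
    then have "x <# (g <# ?K) \<in> translates G A"
      using x g by (auto simp: translates_def)
    moreover have "(x <# (g <# ?K)) \<inter> A \<noteq> {}"
    proof -
      obtain y where y: "y \<in> g <# ?K" "y \<in> ?K" using g by blast
      then have "x \<otimes> y \<in> x <# (g <# ?K)" "x \<otimes> y \<in> x <# ?K"
        by (auto simp: l_coset_eq_image)
      moreover have "x <# ?K = A" using l_coset_cancel(2)[OF x A(1)] .
      ultimately show ?thesis by blast
    qed
    ultimately have "x <# (g <# ?K) = A" by (rule cl)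
    then have "inv x <# (x <# (g <# ?K)) = ?K" by simp
    then show ?thesis using l_coset_cancel(1)[OF x, of "g <# ?K"] K g l_coset_subset_G by simp
  qed
  have stab: "inv k <# ?K = ?K" "k <# ?K = ?K" if k: "k \<in> ?K" for k
  proof -
    have kc: "k \<in> carrier G" using k K by blast
    have "\<one> \<in> inv k <# ?K" using kc k K by (simp add: mem_l_coset_iff)
    then show *: "inv k <# ?K = ?K" using clK[of "inv k"] one kc by auto
    then show "k <# ?K = ?K" using l_coset_cancel(2)[OF kc K] by simp
  qed
  show ?thesis
  proof (rule subgroupI)
    show "?K \<subseteq> carrier G" by (rule K)
    show "?K \<noteq> {}" using one by blast
    show "inv k \<in> ?K" if "k \<in> ?K" for k
    proof -
      have "inv k \<otimes> \<one> \<in> inv k <# ?K" using one by (auto simp: l_coset_eq_image)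
      then show ?thesis using stab that K by auto
    qed
    show "k \<otimes> l \<in> ?K" if "k \<in> ?K" "l \<in> ?K" for k l
    proof -
      have "k \<otimes> l \<in> k <# ?K" using that by (auto simp: l_coset_eq_image)
      then show ?thesis using stab that by auto
    qed
  qed
qed

end

text \<open>The number \<open>\<alpha>\<close> is a lower bound for the sizes of all fragments of \<open>S\<close> and of its inverse set; an atom
is a fragment with exactly \<open>\<alpha>\<close> elements. Atoms with two elements are treated separately below.\<close>

locale atomic = isoperimetric +
  fixes \<alpha> :: nat
  assumes three_le: "3 \<le> \<alpha>"
    and atom_le: "\<And>F. fragment G S k F \<Longrightarrow> \<alpha> \<le> card F"
    and dual_atom_le: "\<And>F. fragment G (set_inv S) k F \<Longrightarrow> \<alpha> \<le> card F"
begin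

lemma dual_atomic: "atomic G (set_inv S) k \<alpha>"
proof -
  interpret dual: isoperimetric G "set_inv S" k by (rule dual)
  show ?thesis
    by unfold_locales
      (use three_le atom_le dual_atom_le in \<open>auto simp: set_inv_set_inv S_subset\<close>)
qed

lemma fragment_bound: "fragment G S k F \<Longrightarrow> card F + \<alpha> + k \<le> order G"
  using fragment_cofragment(3)[of F] dual_atom_le[OF fragment_cofragment(1)[of F]] by linarith

lemma fragmentD:
  assumes "fragment G S k F"
  shows "F \<subseteq> carrier G" "finite F" "card (F <#> S) = card F + k" "card (F <#> S) + 2 \<le> order G" "2 \<le> card F"
  using assms finite_sub by (auto simp: fragment_def)

lemma card_mult_inter:
  assumes A: "fragment G S k A" and F: "fragment G S k F" and ne: "A \<inter> F \<noteq> {}"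
  shows "card (A \<inter> F) + k \<le> card ((A \<inter> F) <#> S)" "card ((A \<inter> F) <#> S) + 2 \<le> order G"
proof -
  note A' = fragmentD[OF A]
  have "card ((A \<inter> F) <#> S) \<le> card (A <#> S)"
    using A' mult_subset finite_sub by (intro card_mono mono_set_mult) auto
  then show "card ((A \<inter> F) <#> S) + 2 \<le> order G" using A' by simp
  then show "card (A \<inter> F) + k \<le> card ((A \<inter> F) <#> S)"
    using A' ne by (intro expansion_nonempty) auto
qed

lemma card_mult_union:
  assumes A: "fragment G S k A" and F: "fragment G S k F" and ne: "A \<inter> F \<noteq> {}"
  shows "card ((A \<inter> F) <#> S) + card ((A \<union> F) <#> S) \<le> card (A \<inter> F) + card (A \<union> F) + 2 * k"
    "card ((A \<union> F) <#> S) \<le> card (A \<union> F) + k"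
proof -
  note A' = fragmentD[OF A] and F' = fragmentD[OF F]
  have "card A + card F = card (A \<union> F) + card (A \<inter> F)" using A' F' by (intro card_Un_Int)
  then show "card ((A \<inter> F) <#> S) + card ((A \<union> F) <#> S) \<le> card (A \<inter> F) + card (A \<union> F) + 2 * k"
    using submodular[of A F] A' F' by simp
  then show "card ((A \<union> F) <#> S) \<le> card (A \<union> F) + k"
    using card_mult_inter[OF A F ne] by simp
qed

text \<open>The fundamental property of atoms. By submodularity, the intersection would otherwise be a
fragment smaller than an atom; the bound \<open>fragment_bound\<close> makes the union admissible.\<close>

lemma atom_subset_fragment:
  assumes A: "fragment G S k A" "card A = \<alpha>" and F: "fragment G S k F" and two: "2 \<le> card (A \<inter> F)"
  shows "A \<subseteq> F"
proof -
  note A' = fragmentD[OF A(1)] and F' = fragmentD[OF F]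
  have ne: "A \<inter> F \<noteq> {}" using two by auto
  note i = card_mult_inter[OF A(1) F ne] and u = card_mult_union[OF A(1) F ne]
  have c: "card A + card F = card (A \<union> F) + card (A \<inter> F)" using A' F' by (intro card_Un_Int)
  have small: "card ((A \<union> F) <#> S) + 2 \<le> order G"
    using u c two A fragment_bound[OF F] by linarith
  have "card (A \<union> F) + k \<le> card ((A \<union> F) <#> S)"
    using small A' F' ne by (intro expansion_nonempty) auto
  then have "card ((A \<inter> F) <#> S) = card (A \<inter> F) + k" using u i by linarith
  then have "fragment G S k (A \<inter> F)"
    unfolding fragment_def using i two A' by auto
  then have "\<alpha> \<le> card (A \<inter> F)" by (rule atom_le)
  then have "A \<inter> F = A" using A A' card_subset_eq[of A "A \<inter> F"]
    by (metis card_mono inf_le1 le_antisym)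
  then show ?thesis by blast
qed

lemma atom_eq:
  assumes "fragment G S k A" "card A = \<alpha>" "fragment G S k B" "card B = \<alpha>" "2 \<le> card (A \<inter> B)"
  shows "A = B"
  using atom_subset_fragment[OF assms(1,2,3,5)] fragmentD(2)[OF assms(3)] assms(2,4)
  by (intro card_subset_eq) simp_all

lemma atoms_meet_in_point:
  assumes "fragment G S k A" "card A = \<alpha>" "fragment G S k B" "card B = \<alpha>" "A \<noteq> B"
    "z \<in> A" "z \<in> B"
  shows "A \<inter> B = {z}"
proof -
  have "finite (A \<inter> B)" using fragmentD(2)[OF assms(1)] by simp
  moreover have "\<not> 2 \<le> card (A \<inter> B)" using atom_eq[OF assms(1-4)] assms(5) by blast
  moreover have "z \<in> A \<inter> B" using assms(6,7) by simp
  ultimately show ?thesis using singleton_if_card_less_two by metis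
qed

lemma card_union_in_point:
  assumes "finite A" "finite F" "A \<inter> F = {z}"
  shows "card (A \<union> F) + 1 = card A + card F"
  using card_Un_Int[of A F] assms by simp

text \<open>An atom attached to a fragment at a single point enlarges it to a fragment, as long as there is
room.\<close>

lemma union_fragment:
  assumes A: "fragment G S k A" "card A = \<alpha>" and F: "fragment G S k F" and one: "A \<inter> F = {z}"
    and room: "card F + \<alpha> + k < order G"
  shows "fragment G S k (A \<union> F)"
proof -
  note A' = fragmentD[OF A(1)] and F' = fragmentD[OF F]
  have ne: "A \<inter> F \<noteq> {}" using one by auto
  note u = card_mult_union[OF A(1) F ne]
  have c: "card (A \<union> F) + 1 = card A + card F" using A' F' one by (intro card_union_in_point) auto
  have small: "card ((A \<union> F) <#> S) + 2 \<le> order G"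
    using u c A room by linarith
  have "card (A \<union> F) + k \<le> card ((A \<union> F) <#> S)"
    using small A' F' ne by (intro expansion_nonempty) auto
  then show ?thesis unfolding fragment_def using small u c A' F' by auto
qed

text \<open>The point common to two atoms has \<open>card S - 1\<close> as its excess. Submodularity leaves no space between
this value and \<open>k\<close>.\<close>

lemma card_S_if_atoms_meet:
  assumes A: "fragment G S k A" "card A = \<alpha>" and B: "fragment G S k B" "card B = \<alpha>"
    and z: "A \<inter> B = {z}"
  shows "card S = k + 1"
proof -
  note A' = fragmentD[OF A(1)] and B' = fragmentD[OF B(1)]
  have ne: "A \<inter> B \<noteq> {}" using z by auto
  note u = card_mult_union[OF A(1) B(1) ne]
  have c: "card (A \<union> B) + 1 = card A + card B" using A' B' z by (intro card_union_in_point) auto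
  have "z \<in> carrier G" using z A' by blast
  then have s: "card ((A \<inter> B) <#> S) = card S"
    using S_subset by (simp add: z l_coset_eq_set_mult[symmetric] card_l_coset)
  have "card (A \<union> B) + k \<le> card ((A \<union> B) <#> S)"
  proof (cases "card ((A \<union> B) <#> S) + 2 \<le> order G")
    case True
    then show ?thesis using A' B' ne by (intro expansion_nonempty) auto
  next
    case False
    then show ?thesis using fragment_bound[OF A(1)] c A B by linarith
  qed
  then show ?thesis using u s k_less z by simp
qed

lemma translate_atom:
  assumes "fragment G S k A" "card A = \<alpha>" "B \<in> translates G A"
  shows "fragment G S k B" "card B = \<alpha>"
proof -
  obtain g where g: "g \<in> carrier G" "B = g <# A" using assms(3) unfolding translates_def by blast
  show "fragment G S k B" unfolding g(2) using fragment_l_coset[OF assms(1) g(1)] .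
  show "card B = \<alpha>" unfolding g(2) using card_l_coset[OF g(1) fragmentD(1)[OF assms(1)]] assms(2) by simp
qed

end

section \<open>Atoms that are cosets, and groups of the smallest possible order\<close>

text \<open>Some non-trivial proper subgroup has a small product with \<open>S\<close>.\<close>

definition subgroup_critical :: "('a, 'b) monoid_scheme \<Rightarrow> 'a set \<Rightarrow> bool" where
  "subgroup_critical G S \<longleftrightarrow> (\<exists>H. subgroup H G \<and> H \<noteq> {\<one>\<^bsub>G\<^esub>} \<and> H \<noteq> carrier G \<and>
     card (H <#>\<^bsub>G\<^esub> S) \<le> card H + card S - 1)"

text \<open>The exceptional structure: a union of two right cosets \<open>H\<close> and \<open>Ha\<close> with \<open>HaH\<close> as large as possible,
whose product with \<open>S\<close> has exactly \<open>card (H \<union> Ha) + card S - 1\<close> elements and whose complement has that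
size too.\<close>

definition two_coset_critical :: "('a, 'b) monoid_scheme \<Rightarrow> 'a set \<Rightarrow> bool" where
  "two_coset_critical G S \<longleftrightarrow> (\<exists>H. \<exists>a\<in>carrier G. subgroup H G \<and>
     card ((H #>\<^bsub>G\<^esub> a) <#>\<^bsub>G\<^esub> H) = (card H)\<^sup>2 \<and>
     card ((H \<union> (H #>\<^bsub>G\<^esub> a)) <#>\<^bsub>G\<^esub> S) = card (H \<union> (H #>\<^bsub>G\<^esub> a)) + card S - 1 \<and>
     card (H \<union> (H #>\<^bsub>G\<^esub> a)) + card S - 1 = order G - card (H \<union> (H #>\<^bsub>G\<^esub> a)))"

context isoperimetric
begin

lemma coset_fragment_imp_subgroup:
  assumes F: "fragment G S k A"
    and cl: "\<And>B. B \<in> translates G A \<Longrightarrow> B \<inter> A \<noteq> {} \<Longrightarrow> B = A"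
  shows "subgroup_critical G S"
proof -
  have A: "A \<subseteq> carrier G" "2 \<le> card A" using F by (auto simp: fragment_def)
  then have "A \<noteq> {}" by auto
  then obtain x where x: "x \<in> A" by blast
  then have xc: "x \<in> carrier G" using A by blast
  let ?H = "inv x <# A"
  have "fragment G S k ?H" using F xc by (simp add: fragment_l_coset)
  then have H: "2 \<le> card ?H" "card (?H <#> S) + 2 \<le> order G" "card (?H <#> S) = card ?H + k"
    by (auto simp: fragment_def)
  have "?H \<noteq> {\<one>}" using H by auto
  moreover have "?H \<noteq> carrier G" using H by (auto simp: order_def)
  moreover have "card (?H <#> S) \<le> card ?H + card S - 1" using H k_less by simp
  moreover have "subgroup ?H G" using A x cl by (intro coset_if_translates_disjoint)
  ultimately show ?thesis unfolding subgroup_critical_def by blast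
qed

end

context group
begin

lemma card_subgroup_coset_product:
  assumes H: "subgroup H G" and a: "a \<in> carrier G"
    and disj: "\<And>h. h \<in> H \<Longrightarrow> inv a \<otimes> h \<otimes> a \<in> H \<Longrightarrow> h = \<one>"
  shows "card ((H #> a) <#> H) = (card H)\<^sup>2"
proof -
  have Hc: "H \<subseteq> carrier G" using H by (rule subgroup.subset)
  let ?f = "\<lambda>(h, k). h \<otimes> a \<otimes> k"
  have im: "(H #> a) <#> H = ?f ` (H \<times> H)" by (auto simp: set_mult_def r_coset_def)
  have "inj_on ?f (H \<times> H)"
  proof (rule inj_onI, clarify)
    fix h k h' k' assume m: "h \<in> H" "k \<in> H" "h' \<in> H" "k' \<in> H" and eq: "h \<otimes> a \<otimes> k = h' \<otimes> a \<otimes> k'"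
    have c: "h \<in> carrier G" "k \<in> carrier G" "h' \<in> carrier G" "k' \<in> carrier G" using m Hc by auto
    have "inv a \<otimes> (inv h' \<otimes> h) \<otimes> a = inv a \<otimes> inv h' \<otimes> (h \<otimes> a \<otimes> k) \<otimes> inv k"
      using c a by (simp add: m_assoc inv_cancel_left)
    also have "\<dots> = k' \<otimes> inv k" unfolding eq using c a by (simp add: m_assoc inv_cancel_left)
    finally have "inv a \<otimes> (inv h' \<otimes> h) \<otimes> a \<in> H"
      using m H by (simp add: subgroup.m_closed subgroup.m_inv_closed)
    moreover have "inv h' \<otimes> h \<in> H" using m H by (simp add: subgroup.m_closed subgroup.m_inv_closed)
    ultimately have "inv h' \<otimes> h = \<one>" using disj by blast
    then have "h = h'" using inv_cancel_left(2)[of h' h] c by simp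
    moreover then have "k = k'" using eq c a by simp
    ultimately show "h = h' \<and> k = k'" by simp
  qed
  then have "card ((H #> a) <#> H) = card (H \<times> H)" unfolding im by (rule card_image)
  then show ?thesis by (simp add: card_cartesian_product power2_eq_square)
qed

end

context atomic
begin

text \<open>If three translates passed through \<open>z\<close>, their cofragments would be three atoms of the inverse set,
pairwise meeting in at most one point, inside the complement of \<open>zS\<close>. That complement has \<open>2\<alpha> - 1\<close>
elements and is covered by two of them, so the third would have at most two elements.\<close>

lemma two_translates_through_point:
  assumes A: "fragment G S k A" "card A = \<alpha>" and n: "order G = 2 * \<alpha> + k"
    and BC: "B \<in> translates G A" "C \<in> translates G A" "D \<in> translates G A"
    and z: "z \<in> B" "z \<in> C" "z \<in> D" and ne: "B \<noteq> C"
  shows "D = B \<or> D = C"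
proof (rule ccontr)
  assume "\<not> (D = B \<or> D = C)"
  then have ne': "D \<noteq> B" "D \<noteq> C" by auto
  interpret dual: atomic G "set_inv S" k \<alpha> by (rule dual_atomic)
  note t = translate_atom[OF A]
  note fB = t[OF BC(1)] and fC = t[OF BC(2)] and fD = t[OF BC(3)]
  have zc: "z \<in> carrier G" using z fragmentD[OF fB(1)] by blast
  have kS: "card S = k + 1"
    using card_S_if_atoms_meet[OF fB fC] atoms_meet_in_point[OF fB fC ne z(1,2)] by blast
  let ?c = "cofragment G S"
  have cf: "fragment G (set_inv S) k (?c F)" "card (?c F) = \<alpha>" if "fragment G S k F" "card F = \<alpha>" for F
    using fragment_cofragment[OF that(1)] that(2) n by auto
  have inj: "F = F'" if "fragment G S k F" "fragment G S k F'" "?c F = ?c F'" for F F'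
    using fragment_cofragment(2)[OF that(1)] fragment_cofragment(2)[OF that(2)] that(3) by metis
  have sub: "?c F \<subseteq> carrier G - (z <# S)" if "z \<in> F" for F
    using that by (auto simp: cofragment_def set_mult_def l_coset_def)
  have zS: "z <# S \<subseteq> carrier G" using zc S_subset by (rule l_coset_subset_G[rotated])
  have "card (carrier G - (z <# S)) + card S = order G"
    using card_compl[OF zS] card_l_coset[OF zc S_subset] by simp
  then have size: "card (carrier G - (z <# S)) + 1 = 2 * \<alpha>" using n kS by simp
  have le1: "card (?c F \<inter> ?c F') \<le> 1" if "fragment G S k F" "card F = \<alpha>" "fragment G S k F'" "card F' = \<alpha>" "F \<noteq> F'" for F F'
  proof -
    have "\<not> 2 \<le> card (?c F \<inter> ?c F')"
      using dual.atom_eq[OF cf[OF that(1,2)] cf[OF that(3,4)]] inj[OF that(1,3)] that(5) by blast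
    then show ?thesis by linarith
  qed
  have fin: "finite (?c F)" for F using finite_sub cofragment_subset by blast
  have "card (?c B) + card (?c C) = card (?c B \<union> ?c C) + card (?c B \<inter> ?c C)"
    using fin by (intro card_Un_Int)
  then have "2 * \<alpha> \<le> card (?c B \<union> ?c C) + 1"
    using le1[OF fB fC ne] cf[OF fB] cf[OF fC] by linarith
  then have "?c B \<union> ?c C = carrier G - (z <# S)"
    using size sub[OF z(1)] sub[OF z(2)] finite_carrier by (intro card_seteq) auto
  then have "?c D \<subseteq> (?c D \<inter> ?c B) \<union> (?c D \<inter> ?c C)" using sub[OF z(3)] by blast
  then have "card (?c D) \<le> card ((?c D \<inter> ?c B) \<union> (?c D \<inter> ?c C))"
    using fin by (intro card_mono) auto
  also have "\<dots> \<le> card (?c D \<inter> ?c B) + card (?c D \<inter> ?c C)" by (rule card_Un_le)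
  also have "\<dots> \<le> 2" using le1[OF fD fB ne'(1)] le1[OF fD fC ne'(2)] by linarith
  finally show False using cf[OF fD] three_le by linarith
qed

text \<open>After a translation the atom contains \<open>\<one>\<close>, and only one other translate \<open>D\<close> passes through \<open>\<one>\<close>. With
\<open>H\<close> the stabiliser of the atom and \<open>a\<close> an element that carries \<open>D\<close> to the atom, the atom is \<open>H \<union> Ha\<close>.
The intersection of \<open>H\<close> with its conjugate by \<open>a\<close> is trivial since \<open>D\<close> meets the atom only in \<open>\<one>\<close>.\<close>

lemma small_order_structure:
  assumes A0: "fragment G S k A0" "card A0 = \<alpha>" and n: "order G = 2 * \<alpha> + k"
    and B0: "B0 \<in> translates G A0" "B0 \<inter> A0 \<noteq> {}" "B0 \<noteq> A0"
  shows "two_coset_critical G S"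
proof -
  have A0c: "A0 \<subseteq> carrier G" using fragmentD[OF A0(1)] by blast
  obtain x where x: "x \<in> A0" using B0 by blast
  have xc: "x \<in> carrier G" using x A0c by blast
  define A where "A = inv x <# A0"
  have At: "A \<in> translates G A0" using xc by (auto simp: A_def translates_def)
  have A: "fragment G S k A" "card A = \<alpha>" using translate_atom[OF A0 At] by auto
  have Ac: "A \<subseteq> carrier G" using fragmentD[OF A(1)] by blast
  have one: "\<one> \<in> A" using x xc A0c by (simp add: A_def mem_l_coset_iff)
  have gA: "g <# A \<in> translates G A0" if "g \<in> carrier G" for g
    using translate_translate[OF A0c At that] .
  obtain D where D: "D \<in> translates G A0" "\<one> \<in> D" "D \<noteq> A"
    using other_translate_through_point[OF A0c B0, of \<one> A] by auto
  have D': "fragment G S k D" "card D = \<alpha>" using translate_atom[OF A0 D(1)] by auto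
  have DA: "A \<inter> D = {\<one>}" using atoms_meet_in_point[OF A D'] D one by auto
  have kS: "card S = k + 1" using card_S_if_atoms_meet[OF A D' DA] .
  have dich: "inv b <# A = A \<or> inv b <# A = D" if b: "b \<in> A" for b
  proof -
    have bc: "b \<in> carrier G" using b Ac by blast
    have "\<one> \<in> inv b <# A" using b bc Ac by (simp add: mem_l_coset_iff)
    then show ?thesis
      using two_translates_through_point[OF A0 n At D(1) gA[of "inv b"] one D(2)] bc D(3)
      by (metis inv_closed)
  qed
  obtain g where g: "g \<in> carrier G" "D = g <# A"
  proof -
    obtain h where h: "h \<in> carrier G" "D = h <# A0" using D by (auto simp: translates_def)
    have "D = (h \<otimes> x) <# A" unfolding A_def h(2) using h xc A0c
      by (simp add: lcos_m_assoc m_assoc)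
    then show thesis using that[of "h \<otimes> x"] h xc by simp
  qed
  define a where "a = inv g"
  have a: "a \<in> carrier G" "D = inv a <# A" using g by (simp_all add: a_def)
  have aA: "a \<in> A" using D(2) a Ac by (simp add: mem_l_coset_iff)
  define H where "H = {h \<in> carrier G. h <# A = A}"
  have H: "subgroup H G"
  proof (rule subgroupI)
    show "H \<subseteq> carrier G" by (auto simp: H_def)
    show "H \<noteq> {}" using lcos_mult_one[OF Ac] by (auto simp: H_def)
    show "inv h \<in> H" if "h \<in> H" for h
      using that l_coset_cancel(1)[OF _ Ac, of h] by (auto simp: H_def)
    show "h \<otimes> l \<in> H" if "h \<in> H" "l \<in> H" for h l
      using that lcos_m_assoc[OF Ac, of h l] by (auto simp: H_def)
  qed
  have HA: "h \<otimes> y \<in> A" if "h \<in> H" "y \<in> A" for h y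
  proof -
    have "h \<otimes> y \<in> h <# A" using that by (auto simp: l_coset_eq_image)
    then show ?thesis using that by (simp add: H_def)
  qed
  have AH: "A = H \<union> (H #> a)"
  proof
    have "h \<in> A" if "h \<in> H" for h using HA[OF that one] that by (simp add: H_def)
    moreover have "H #> a \<subseteq> A" using HA aA by (auto simp: r_coset_def)
    ultimately show "H \<union> (H #> a) \<subseteq> A" by blast
    show "A \<subseteq> H \<union> (H #> a)"
    proof
      fix b assume b: "b \<in> A"
      then have bc: "b \<in> carrier G" using Ac by blast
      consider "inv b <# A = A" | "inv b <# A = inv a <# A" using dich[OF b] a by auto
      then show "b \<in> H \<union> (H #> a)"
      proof cases
        case 1
        then have "b <# A = A" using l_coset_cancel(2)[OF bc Ac] by simp
        then show ?thesis using bc by (simp add: H_def)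
      next
        case 2
        have "b \<otimes> inv a <# A = b <# (inv b <# A)"
          unfolding 2 using bc a Ac by (simp add: lcos_m_assoc)
        also have "\<dots> = A" using l_coset_cancel(2)[OF bc Ac] .
        finally have "b \<otimes> inv a \<in> H" using bc a by (simp add: H_def)
        moreover have "b = b \<otimes> inv a \<otimes> a" using bc a by (simp add: m_assoc)
        ultimately show ?thesis by (auto simp: r_coset_def)
      qed
    qed
  qed
  have disj: "h = \<one>" if h: "h \<in> H" "inv a \<otimes> h \<otimes> a \<in> H" for h
  proof -
    have hc: "h \<in> carrier G" using h by (simp add: H_def)
    have "h \<otimes> a \<in> A" using HA[OF h(1) aA] .
    then have "inv a \<otimes> (h \<otimes> a) \<in> D" unfolding a(2) by (auto simp: l_coset_eq_image)
    then have "inv a \<otimes> h \<otimes> a \<in> A \<inter> D" using h(2) AH hc a by (auto simp: m_assoc)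
    then have "inv a \<otimes> h \<otimes> a = \<one>" using DA by blast
    then have "a \<otimes> (inv a \<otimes> h \<otimes> a) \<otimes> inv a = a \<otimes> \<one> \<otimes> inv a" by simp
    moreover have "a \<otimes> (inv a \<otimes> h \<otimes> a) \<otimes> inv a = h"
      using hc a by (simp add: m_assoc inv_cancel_left)
    ultimately show ?thesis using a by simp
  qed
  have "card ((H #> a) <#> H) = (card H)\<^sup>2"
    using card_subgroup_coset_product[OF H a(1) disj] .
  moreover have "card (A <#> S) = card A + card S - 1" "card A + card S - 1 = order G - card A"
    using fragmentD[OF A(1)] kS A n by auto
  ultimately show ?thesis unfolding two_coset_critical_def using H a(1) AH by blast
qed

end

section \<open>Paths of atoms\<close>

context atomic
begin

text \<open>A leaf of \<open>F\<close> is a part \<open>W\<close>, one point short of a whole translate \<open>L \<subseteq> F\<close>, that is met by no other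
translate contained in \<open>F\<close>.\<close>

definition leaf :: "'a set \<Rightarrow> 'a set \<Rightarrow> 'a set \<Rightarrow> bool" where
  "leaf A F W \<longleftrightarrow> (\<exists>L \<in> translates G A. W \<subseteq> L \<and> L \<subseteq> F \<and> card W = \<alpha> - 1 \<and>
     (\<forall>C \<in> translates G A. C \<subseteq> F \<longrightarrow> C \<inter> W \<noteq> {} \<longrightarrow> C = L))"

text \<open>The fragment \<open>F\<close> is a path of translates of \<open>A\<close> whose last translate is \<open>L\<close>, attached to the previous ones
at \<open>y\<close>. The sequence of translates itself is not recorded, only that \<open>F\<close> is covered by them, that \<open>L\<close>
meets the other translates in \<open>F\<close> at most in \<open>y\<close>, and that \<open>F\<close> has no leaves besides \<open>U\<close>, at the first
translate, and \<open>L - {y}\<close>, at the last one.\<close>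

definition atom_path :: "'a set \<Rightarrow> 'a set \<Rightarrow> 'a set \<Rightarrow> 'a set \<Rightarrow> 'a \<Rightarrow> bool" where
  "atom_path A F U L y \<longleftrightarrow> fragment G S k F \<and>
     (\<forall>x\<in>F. \<exists>C \<in> translates G A. x \<in> C \<and> C \<subseteq> F) \<and>
     L \<in> translates G A \<and> L \<subseteq> F \<and> y \<in> L \<and>
     (\<forall>C \<in> translates G A. C \<subseteq> F \<longrightarrow> C \<noteq> L \<longrightarrow> C \<inter> L \<subseteq> {y}) \<and>
     (\<forall>W. leaf A F W \<longrightarrow> W = U \<or> W = L - {y})"

lemma leafE:
  assumes "leaf A F W"
  obtains L where "L \<in> translates G A" "W \<subseteq> L" "L \<subseteq> F" "card W = \<alpha> - 1"
    "\<And>C. C \<in> translates G A \<Longrightarrow> C \<subseteq> F \<Longrightarrow> C \<inter> W \<noteq> {} \<Longrightarrow> C = L"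
  using assms[unfolded leaf_def] by meson

lemma atom_pathD:
  assumes "atom_path A F U L y"
  shows "fragment G S k F" "\<And>x. x \<in> F \<Longrightarrow> \<exists>C \<in> translates G A. x \<in> C \<and> C \<subseteq> F"
    "L \<in> translates G A" "L \<subseteq> F" "y \<in> L"
    "\<And>C. C \<in> translates G A \<Longrightarrow> C \<subseteq> F \<Longrightarrow> C \<noteq> L \<Longrightarrow> C \<inter> L \<subseteq> {y}"
    "\<And>W. leaf A F W \<Longrightarrow> W = U \<or> W = L - {y}"
  using assms[unfolded atom_path_def] by meson+

lemma leaf_eq_delete:
  assumes A: "fragment G S k A" "card A = \<alpha>" and L: "L \<in> translates G A" "y \<in> L"
    and W: "W \<subseteq> L" "card W = \<alpha> - 1" "y \<notin> W"
  shows "W = L - {y}"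
proof (rule card_subset_eq)
  note f = translate_atom[OF A L(1)]
  show "finite (L - {y})" using fragmentD(2)[OF f(1)] by simp
  show "W \<subseteq> L - {y}" using W by blast
  show "card W = card (L - {y})" using W f L fragmentD(2)[OF f(1)] by simp
qed

text \<open>Attaching an atom to a fragment creates no further atoms: since \<open>\<alpha> \<ge> 3\<close>, an atom in the union meets
one of the two parts in at least two points.\<close>

lemma atom_in_union:
  assumes A: "fragment G S k A" "card A = \<alpha>" and C: "C \<in> translates G A"
    and E: "E \<in> translates G A" "E \<subseteq> F \<union> C" and F: "fragment G S k F"
  shows "E \<subseteq> F \<or> E = C"
proof (rule ccontr)
  assume "\<not> ?thesis"
  then have n: "\<not> E \<subseteq> F" "E \<noteq> C" by auto
  note fE = translate_atom[OF A E(1)] and fC = translate_atom[OF A C]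
  have "\<not> 2 \<le> card (E \<inter> F)" using atom_subset_fragment[OF fE F] n by blast
  moreover have "\<not> 2 \<le> card (E \<inter> C)" using atom_eq[OF fE fC] n by blast
  moreover have "card E \<le> card (E \<inter> F) + card (E \<inter> C)"
  proof -
    have "E = (E \<inter> F) \<union> (E \<inter> C)" using E by blast
    then show ?thesis using card_Un_le[of "E \<inter> F" "E \<inter> C"] by simp
  qed
  ultimately show False using fE three_le by linarith
qed

lemma atom_path_start:
  assumes A: "fragment G S k A" "card A = \<alpha>" and n: "2 * \<alpha> + k < order G"
    and B: "B \<in> translates G A" "B \<inter> A \<noteq> {}" "B \<noteq> A"
  shows "\<exists>F U L y. atom_path A F U L y"
proof -
  note fB = translate_atom[OF A B(1)]
  note A' = fragmentD[OF A(1)]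
  have AA: "A \<in> translates G A" using translate_self A' by blast
  obtain y where y: "y \<in> B" "y \<in> A" using B by blast
  have BA: "B \<inter> A = {y}" using atoms_meet_in_point[OF fB A B(3) y] .
  have fr: "fragment G S k (B \<union> A)" using union_fragment[OF fB A(1) BA] A n by simp
  have at: "C = A \<or> C = B" if C: "C \<in> translates G A" "C \<subseteq> B \<union> A" for C
  proof -
    have "C \<subseteq> A \<or> C = B" using atom_in_union[OF A B(1) C(1) _ A(1)] C(2) by blast
    moreover have "C \<subseteq> A \<Longrightarrow> C = A"
      using card_subset_eq[OF A'(2)] translate_atom(2)[OF A C(1)] A(2) by simp
    ultimately show ?thesis by blast
  qed
  have lf: "W = A - {y} \<or> W = B - {y}" if W: "leaf A (B \<union> A) W" for W
  proof -
    obtain L where L: "L \<in> translates G A" "W \<subseteq> L" "L \<subseteq> B \<union> A" "card W = \<alpha> - 1"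
      and un: "\<And>C. C \<in> translates G A \<Longrightarrow> C \<subseteq> B \<union> A \<Longrightarrow> C \<inter> W \<noteq> {} \<Longrightarrow> C = L"
      using leafE[OF W] by metis
    have "y \<notin> W"
    proof
      assume "y \<in> W"
      then have "A = L" "B = L" using un[OF AA] un[OF B(1)] y by blast+
      then show False using B(3) by simp
    qed
    moreover have "y \<in> L" using at[OF L(1,3)] y by metis
    ultimately have "W = L - {y}" using leaf_eq_delete[OF A L(1) _ L(2,4)] by metis
    then show ?thesis using at[OF L(1,3)] by blast
  qed
  have "atom_path A (B \<union> A) (A - {y}) B y"
    unfolding atom_path_def
  proof (intro conjI ballI allI impI)
    show "fragment G S k (B \<union> A)" by (rule fr)
    show "\<exists>C\<in>translates G A. x \<in> C \<and> C \<subseteq> B \<union> A" if "x \<in> B \<union> A" for x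
      using that AA B(1) by blast
    show "B \<in> translates G A" by (rule B(1))
    show "B \<subseteq> B \<union> A" by blast
    show "y \<in> B" by (rule y)
    show "C \<inter> B \<subseteq> {y}" if "C \<in> translates G A" "C \<subseteq> B \<union> A" "C \<noteq> B" for C
      using at[OF that(1,2)] that(3) BA by blast
    show "W = A - {y} \<or> W = B - {y}" if "leaf A (B \<union> A) W" for W
      using lf[OF that] .
  qed
  then show ?thesis by blast
qed

text \<open>The path is continued by a second translate \<open>C\<close> through a point \<open>z \<noteq> y\<close> of its last translate \<open>L\<close>. Then
\<open>L - {y}\<close> is no longer a leaf, because it contains \<open>z\<close>, and \<open>C - {z}\<close> takes its place.\<close>

lemma atom_path_extend:
  assumes A: "fragment G S k A" "card A = \<alpha>"
    and B: "B \<in> translates G A" "B \<inter> A \<noteq> {}" "B \<noteq> A"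
    and p: "atom_path A F U L y" and room: "card F + \<alpha> + k < order G"
  shows "\<exists>F' U' L' y'. atom_path A F' U' L' y' \<and> card F < card F'"
proof -
  have F: "fragment G S k F" and cov: "\<And>x. x \<in> F \<Longrightarrow> \<exists>C \<in> translates G A. x \<in> C \<and> C \<subseteq> F"
    and L: "L \<in> translates G A" "L \<subseteq> F" "y \<in> L"
    and meet: "\<And>C. C \<in> translates G A \<Longrightarrow> C \<subseteq> F \<Longrightarrow> C \<noteq> L \<Longrightarrow> C \<inter> L \<subseteq> {y}"
    and lv: "\<And>W. leaf A F W \<Longrightarrow> W = U \<or> W = L - {y}"
    using atom_pathD[OF p] by metis+
  note fL = translate_atom[OF A L(1)] and F' = fragmentD[OF F]
  have "L \<noteq> {y}" using fL three_le by auto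
  then obtain z where z: "z \<in> L" "z \<noteq> y" using L by blast
  then have zc: "z \<in> carrier G" "z \<in> F" using L F' by blast+
  obtain C where C: "C \<in> translates G A" "z \<in> C" "C \<noteq> L"
    using other_translate_through_point[OF fragmentD(1)[OF A(1)] B zc(1)] by blast
  note fC = translate_atom[OF A C(1)]
  have nC: "\<not> C \<subseteq> F" using meet[OF C(1) _ C(3)] C(2) z by blast
  have "\<not> 2 \<le> card (C \<inter> F)" using atom_subset_fragment[OF fC F] nC by blast
  moreover have "finite (C \<inter> F)" using F' by simp
  moreover have "z \<in> C \<inter> F" using zc C by blast
  ultimately have CF: "C \<inter> F = {z}" using singleton_if_card_less_two by metis
  have fr: "fragment G S k (C \<union> F)" using union_fragment[OF fC F CF room] .
  have at: "E \<subseteq> F \<or> E = C" if E: "E \<in> translates G A" "E \<subseteq> C \<union> F" for E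
    using atom_in_union[OF A C(1) E(1) _ F] E(2) by blast
  have lf: "W = U \<or> W = C - {z}" if W: "leaf A (C \<union> F) W" for W
  proof -
    obtain M where M: "M \<in> translates G A" "W \<subseteq> M" "M \<subseteq> C \<union> F" "card W = \<alpha> - 1"
      and un: "\<And>E. E \<in> translates G A \<Longrightarrow> E \<subseteq> C \<union> F \<Longrightarrow> E \<inter> W \<noteq> {} \<Longrightarrow> E = M"
      using leafE[OF W] by metis
    have zW: "z \<notin> W"
    proof
      assume "z \<in> W"
      then have "C = M" "L = M" using un[OF C(1)] un[OF L(1)] L(2) z C(2) by blast+
      then show False using C(3) by simp
    qed
    show ?thesis
    proof (cases "M = C")
      case True
      then show ?thesis using leaf_eq_delete[OF A C(1,2) _ M(4) zW] M(2) by metis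
    next
      case False
      then have "M \<subseteq> F" using at[OF M(1,3)] by blast
      moreover have "E = M" if "E \<in> translates G A" "E \<subseteq> F" "E \<inter> W \<noteq> {}" for E
        using un[OF that(1) _ that(3)] that(2) by blast
      ultimately have "leaf A F W" unfolding leaf_def using M by metis
      then have "W = U \<or> W = L - {y}" by (rule lv)
      then show ?thesis using zW z by blast
    qed
  qed
  have "atom_path A (C \<union> F) U C z"
    unfolding atom_path_def
  proof (intro conjI ballI allI impI)
    show "fragment G S k (C \<union> F)" by (rule fr)
    show "\<exists>D\<in>translates G A. x \<in> D \<and> D \<subseteq> C \<union> F" if x: "x \<in> C \<union> F" for x
    proof (cases "x \<in> C")
      case True
      then show ?thesis using C(1) by blast
    next
      case False
      then have "x \<in> F" using x by blast
      from cov[OF this] show ?thesis by blast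
    qed
    show "C \<in> translates G A" by (rule C(1))
    show "C \<subseteq> C \<union> F" by blast
    show "z \<in> C" by (rule C(2))
    show "E \<inter> C \<subseteq> {z}" if "E \<in> translates G A" "E \<subseteq> C \<union> F" "E \<noteq> C" for E
      using at[OF that(1,2)] that(3) CF by blast
    show "W = U \<or> W = C - {z}" if "leaf A (C \<union> F) W" for W
      using lf[OF that] .
  qed
  moreover have "card F < card (C \<union> F)"
    using nC F' fragmentD(2)[OF fC(1)] by (intro psubset_card_mono) auto
  ultimately show ?thesis by blast
qed

lemma maximal_atom_path:
  assumes A: "fragment G S k A" "card A = \<alpha>" and n: "2 * \<alpha> + k < order G"
    and B: "B \<in> translates G A" "B \<inter> A \<noteq> {}" "B \<noteq> A"
  shows "\<exists>F U L y. atom_path A F U L y \<and> card F + \<alpha> + k = order G"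
proof -
  let ?P = "\<lambda>F. \<exists>U L y. atom_path A F U L y"
  have fr: "fragment G S k F" if "?P F" for F using that atom_pathD(1) by metis
  have "card F < Suc (order G)" if "?P F" for F using fragment_bound[OF fr[OF that]] by simp
  then obtain F where F: "?P F" "\<And>F'. ?P F' \<Longrightarrow> card F' \<le> card F"
    using ex_has_greatest_nat[of ?P _ card "Suc (order G)"] atom_path_start[OF A n B] by (metis (no_types, lifting))
  have "\<not> card F + \<alpha> + k < order G"
  proof
    assume "card F + \<alpha> + k < order G"
    then obtain F' where "?P F'" "card F < card F'"
      using atom_path_extend[OF A B] F(1) by blast
    then show False using F(2) by (metis leD)
  qed
  then have "card F + \<alpha> + k = order G" using fragment_bound[OF fr[OF F(1)]] by linarith
  then show ?thesis using F(1) by blast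
qed

text \<open>The role of \<open>E\<close> is that of a translate of the largest possible fragment \<open>F\<close> whose cofragment meets
that of \<open>F\<close> only in \<open>d\<close>. The union of \<open>F\<close> and \<open>E\<close> avoids the product of \<open>d\<close> with the inverses of \<open>S\<close>,
which bounds \<open>card (F \<inter> E)\<close> from below; the two cofragments lie outside the product of \<open>F \<inter> E\<close> with
\<open>S\<close>, which bounds it from above. Both bounds are \<open>card F - \<alpha> + 1\<close>, so \<open>F - E\<close> has \<open>\<alpha> - 1\<close> elements, and
a translate in \<open>F\<close> that leaves \<open>E\<close> has at most one point in \<open>E\<close>.\<close>

lemma leaf_from_translate:
  assumes A: "fragment G S k A" "card A = \<alpha>"
    and kS: "card S = k + 1"
    and F: "fragment G S k F" "card F + \<alpha> + k = order G"
    and cov: "\<And>x. x \<in> F \<Longrightarrow> \<exists>C \<in> translates G A. x \<in> C \<and> C \<subseteq> F"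
    and E: "fragment G S k E" "card E = card F"
    and d: "cofragment G S E \<inter> cofragment G S F = {d}"
  shows "leaf A F (F - E)"
    and "cofragment G S (F \<inter> E) = cofragment G S F \<union> cofragment G S E"
proof -
  let ?c = "cofragment G S"
  note F' = fragmentD[OF F(1)] and E' = fragmentD[OF E(1)]
  have dc: "d \<in> carrier G" using d cofragment_subset by blast
  have cF: "card (?c F) = \<alpha>" "card (?c E) = \<alpha>"
    using fragment_cofragment(3)[OF F(1)] fragment_cofragment(3)[OF E(1)] F(2) E(2) by linarith+
  have dF: "d \<in> ?c F" "d \<in> ?c E" using d by blast+
  have invS: "set_inv S \<subseteq> carrier G" using set_inv_subset S_subset .
  have dS: "d <# set_inv S \<subseteq> carrier G" using dc invS by (rule l_coset_subset_G[rotated])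
  have avoid: "V \<subseteq> carrier G - (d <# set_inv S)" if "V \<subseteq> carrier G" "d \<in> ?c V" for V
  proof -
    have "(V <#> S) \<inter> {d} = {}" using that(2) by (auto simp: cofragment_def)
    then have "V \<inter> ({d} <#> set_inv S) = {}"
      using set_mult_disjoint_iff[of V "{d}" S] that(1) dc S_subset by blast
    then show ?thesis using that(1) by (auto simp: l_coset_eq_set_mult[symmetric])
  qed
  have "card (d <# set_inv S) = k + 1"
    using card_l_coset[OF dc invS] card_set_inv[OF S_subset] kS by simp
  then have size: "card (carrier G - (d <# set_inv S)) + k + 1 = order G"
    using card_compl[OF dS] by simp
  have "F \<union> E \<subseteq> carrier G - (d <# set_inv S)"
    using avoid[OF F'(1) dF(1)] avoid[OF E'(1) dF(2)] by blast
  then have "card (F \<union> E) \<le> card (carrier G - (d <# set_inv S))"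
    using finite_carrier by (intro card_mono) auto
  then have un: "card (F \<union> E) + k + 1 \<le> order G" using size by linarith
  have cc: "card F + card E = card (F \<union> E) + card (F \<inter> E)" using F' E' by (intro card_Un_Int)
  then have lower: "card F + 1 \<le> card (F \<inter> E) + \<alpha>" using un F(2) E(2) by linarith
  have "\<alpha> \<le> card F" using atom_le F(1) .
  then have ne: "F \<inter> E \<noteq> {}" using lower by auto
  have sub: "?c F \<union> ?c E \<subseteq> ?c (F \<inter> E)"
    unfolding cofragment_def by (auto simp: set_mult_def)
  have finc: "finite (?c V)" for V using finite_sub cofragment_subset by blast
  have cu: "card (?c F \<union> ?c E) + 1 = 2 * \<alpha>"
    using card_Un_Int[OF finc finc, of F E] cF d by (simp add: Int_commute)
  have "card (?c F \<union> ?c E) \<le> card (?c (F \<inter> E))" using sub finc by (intro card_mono)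
  moreover have FE: "F \<inter> E \<subseteq> carrier G" using F' by blast
  note cFE = card_cofragment[OF FE]
  ultimately have m: "card ((F \<inter> E) <#> S) + 2 * \<alpha> \<le> order G + 1" using cu by linarith
  have "card (F \<inter> E) + k \<le> card ((F \<inter> E) <#> S)"
    using m three_le ne FE by (intro expansion_nonempty) auto
  then have iE: "card (F \<inter> E) + \<alpha> = card F + 1"
    and mm: "card ((F \<inter> E) <#> S) + 2 * \<alpha> = order G + 1" using m lower F(2) by linarith+
  have "card (?c F \<union> ?c E) = card (?c (F \<inter> E))" using cu cFE mm by linarith
  then show "?c (F \<inter> E) = ?c F \<union> ?c E" using card_subset_eq[OF finc sub] by simp
  have cW: "card (F - E) + 1 = \<alpha>"
  proof -
    have "card (F - E) = card F - card (F \<inter> E)" using F' by (intro card_Diff_subset_Int) simp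
    then show ?thesis using iE \<open>\<alpha> \<le> card F\<close> three_le by linarith
  qed
  have big: "F - E \<subseteq> C" if C: "C \<in> translates G A" "C \<subseteq> F" "C \<inter> (F - E) \<noteq> {}" for C
  proof -
    note fC = translate_atom[OF A C(1)]
    have "\<not> 2 \<le> card (C \<inter> E)" using atom_subset_fragment[OF fC E(1)] C(3) by blast
    moreover have "card C = card (C \<inter> E) + card (C \<inter> (F - E))"
    proof -
      have eq: "(C \<inter> E) \<union> (C \<inter> (F - E)) = C" using C(2) by blast
      have "card ((C \<inter> E) \<union> (C \<inter> (F - E))) = card (C \<inter> E) + card (C \<inter> (F - E))"
        using F' E' by (intro card_Un_disjoint) auto
      then show ?thesis unfolding eq .
    qed
    ultimately have "card (F - E) \<le> card (C \<inter> (F - E))" using fC cW by linarith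
    then have "C \<inter> (F - E) = F - E" using F' by (intro card_seteq) auto
    then show ?thesis by blast
  qed
  have "card (F - E) \<noteq> 0" using cW three_le by linarith
  then have "F - E \<noteq> {}" by (metis card.empty)
  then obtain u where u: "u \<in> F - E" by blast
  then obtain L where L: "L \<in> translates G A" "u \<in> L" "L \<subseteq> F" using cov[of u] by blast
  have FL: "F - E \<subseteq> L" using big[OF L(1,3)] u L(2) by blast
  have "C = L" if C: "C \<in> translates G A" "C \<subseteq> F" "C \<inter> (F - E) \<noteq> {}" for C
  proof -
    note fC = translate_atom[OF A C(1)] and fL = translate_atom[OF A L(1)]
    have "card (F - E) \<le> card (C \<inter> L)"
      using big[OF C] FL fragmentD(2)[OF fC(1)] by (intro card_mono) auto
    then have "2 \<le> card (C \<inter> L)" using cW three_le by linarith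
    then show ?thesis using atom_eq[OF fC fL] by blast
  qed
  then show "leaf A F (F - E)" unfolding leaf_def using L FL cW by (metis add_diff_cancel_right')
qed

text \<open>Let \<open>F\<close> be a longest path and \<open>D\<close> its cofragment, an atom of the inverse set. For \<open>d \<in> D\<close> let \<open>e d\<close> be a
translate of \<open>F\<close> whose cofragment meets \<open>D\<close> only in \<open>d\<close>. The map \<open>d \<mapsto> F - e d\<close> from \<open>D\<close> to the leaves
of \<open>F\<close> is injective: the leaf determines
\<open>F \<inter> e d\<close>, hence the union of \<open>D\<close> and the cofragment of \<open>e d\<close>, hence this cofragment up to the point
\<open>d\<close>. Having at least three elements, \<open>D\<close> cannot be mapped injectively to the at most two leaves.\<close>

lemma large_order_contradiction:
  assumes A: "fragment G S k A" "card A = \<alpha>" and n: "2 * \<alpha> + k < order G"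
    and B: "B \<in> translates G A" "B \<inter> A \<noteq> {}" "B \<noteq> A"
    and dualnc: "\<And>D. fragment G (set_inv S) k D \<Longrightarrow> card D = \<alpha> \<Longrightarrow>
                   \<exists>E \<in> translates G D. E \<inter> D \<noteq> {} \<and> E \<noteq> D"
  shows False
proof -
  interpret dual: atomic G "set_inv S" k \<alpha> by (rule dual_atomic)
  obtain F U L y where p: "atom_path A F U L y" and cF: "card F + \<alpha> + k = order G"
    using maximal_atom_path[OF A n B] by blast
  have F: "fragment G S k F" and cov: "\<And>x. x \<in> F \<Longrightarrow> \<exists>C \<in> translates G A. x \<in> C \<and> C \<subseteq> F"
    and lv: "\<And>W. leaf A F W \<Longrightarrow> W = U \<or> W = L - {y}"
    using atom_pathD[OF p] by metis+
  note F' = fragmentD[OF F]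
  note fB = translate_atom[OF A B(1)]
  obtain b where b: "b \<in> B" "b \<in> A" using B by blast
  have kS: "card S = k + 1"
    using card_S_if_atoms_meet[OF fB A atoms_meet_in_point[OF fB A B(3) b]] .
  define D where "D = cofragment G S F"
  have D: "fragment G (set_inv S) k D" "card D = \<alpha>"
    using fragment_cofragment[OF F] cF by (auto simp: D_def)
  note D' = dual.fragmentD[OF D(1)]
  obtain D0 where D0: "D0 \<in> translates G D" "D0 \<inter> D \<noteq> {}" "D0 \<noteq> D" using dualnc[OF D] by blast
  have "\<exists>E. fragment G S k E \<and> card E = card F \<and> cofragment G S E \<inter> D = {d}" if d: "d \<in> D" for d
  proof -
    have dc: "d \<in> carrier G" using d D' by blast
    obtain D1 where D1: "D1 \<in> translates G D" "d \<in> D1" "D1 \<noteq> D"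
      using other_translate_through_point[OF D'(1) D0 dc] by blast
    then obtain g where g: "g \<in> carrier G" "D1 = g <# D" unfolding translates_def by blast
    have "D1 \<inter> D = {d}"
      using dual.atoms_meet_in_point[OF dual.translate_atom[OF D D1(1)] D D1(3,2) d] .
    moreover have "cofragment G S (g <# F) = D1"
      unfolding g(2) D_def using cofragment_l_coset[OF F'(1) g(1)] .
    ultimately show ?thesis
      using fragment_l_coset[OF F g(1)] card_l_coset[OF g(1) F'(1)] by blast
  qed
  then obtain e where e: "\<And>d. d \<in> D \<Longrightarrow> fragment G S k (e d)" "\<And>d. d \<in> D \<Longrightarrow> card (e d) = card F"
    "\<And>d. d \<in> D \<Longrightarrow> cofragment G S (e d) \<inter> D = {d}"
    by metis
  have e': "leaf A F (F - e d)" "cofragment G S (F \<inter> e d) = D \<union> cofragment G S (e d)" if d: "d \<in> D" for d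
    using leaf_from_translate[OF A kS F cF cov e(1)[OF d] e(2)[OF d] e(3)[OF d, unfolded D_def]]
    unfolding D_def by blast+
  have "inj_on (\<lambda>d. F - e d) D"
  proof (rule inj_onI)
    fix d d' assume d: "d \<in> D" "d' \<in> D" and eq: "F - e d = F - e d'"
    have "F \<inter> e d = F \<inter> e d'" using eq by blast
    then have un: "D \<union> cofragment G S (e d) = D \<union> cofragment G S (e d')"
      using e'(2)[OF d(1)] e'(2)[OF d(2)] by simp
    have co: "fragment G (set_inv S) k (cofragment G S (e c))" "card (cofragment G S (e c)) = \<alpha>"
      if "c \<in> D" for c
      using fragment_cofragment(1,3)[OF e(1)[OF that]] e(2)[OF that] cF by auto
    let ?I = "cofragment G S (e d) \<inter> cofragment G S (e d')"
    have "cofragment G S (e d) - {d} \<subseteq> ?I" using un e(3)[OF d(1)] by blast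
    then have "card (cofragment G S (e d) - {d}) \<le> card ?I"
      using dual.fragmentD(2)[OF co(1)[OF d(1)]] by (intro card_mono) auto
    moreover have "d \<in> cofragment G S (e d)" using e(3)[OF d(1)] by blast
    ultimately have "2 \<le> card ?I"
      using co(2)[OF d(1)] three_le dual.fragmentD(2)[OF co(1)[OF d(1)]] by simp
    then have "cofragment G S (e d) = cofragment G S (e d')"
      using dual.atom_eq[OF co[OF d(1)] co[OF d(2)]] by blast
    then have "{d} = {d'}" using e(3)[OF d(1)] e(3)[OF d(2)] by metis
    then show "d = d'" by simp
  qed
  moreover have "F - e d \<in> {U, L - {y}}" if "d \<in> D" for d using lv[OF e'(1)[OF that]] by simp
  then have "(\<lambda>d. F - e d) ` D \<subseteq> {U, L - {y}}" by (rule image_subsetI)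
  ultimately have "card D \<le> card {U, L - {y}}" by (rule card_inj_on_le) simp
  also have "\<dots> \<le> 2" by (simp add: card_insert_if)
  finally show False using D three_le by simp
qed

end

section \<open>Two-element atoms and geometric progressions\<close>

context group
begin

lemma geometric_progression_set_inv:
  assumes S: "S \<subseteq> carrier G" and gp: "geometric_progression G S"
  shows "geometric_progression G (set_inv S)"
proof -
  obtain g a where g: "g \<in> carrier G" and a: "a \<in> carrier G"
    and h: "g <# S = {a [^] i | i::nat. i < card S} \<or> S #> g = {a [^] i | i::nat. i < card S}"
    using gp unfolding geometric_progression_def by blast
  have inv_pow: "m_inv G ` {a [^] i | i::nat. i < card S} = {inv a [^] i | i::nat. i < card S}"
    using nat_pow_inv[OF a] by (auto simp: image_def)
  have l: "set_inv S #> inv g = m_inv G ` (g <# S)"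
    using g S by (force simp: SET_INV_def r_coset_def l_coset_def inv_mult_group)
  have r: "inv g <# set_inv S = m_inv G ` (S #> g)"
    using g S by (force simp: SET_INV_def r_coset_def l_coset_def inv_mult_group)
  have "set_inv S #> inv g = {inv a [^] i | i::nat. i < card S} \<or>
        inv g <# set_inv S = {inv a [^] i | i::nat. i < card S}"
    using h
  proof
    assume "g <# S = {a [^] i | i::nat. i < card S}"
    then have "set_inv S #> inv g = m_inv G ` {a [^] i | i::nat. i < card S}" unfolding l by (rule arg_cong)
    then show ?thesis unfolding inv_pow by (rule disjI1)
  next
    assume "S #> g = {a [^] i | i::nat. i < card S}"
    then have "inv g <# set_inv S = m_inv G ` {a [^] i | i::nat. i < card S}" unfolding r by (rule arg_cong)
    then show ?thesis unfolding inv_pow by (rule disjI2)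
  qed
  then show ?thesis
    unfolding geometric_progression_def card_set_inv[OF S] using g a by blast
qed

text \<open>Left multiplication by \<open>a\<close> leads out of \<open>S\<close> at most at the point \<open>t\<close>. With \<open>H\<close> the cyclic subgroup
generated by \<open>a\<close>, an element of \<open>S\<close> outside \<open>Ht\<close> never leaves \<open>S\<close>, so \<open>HS \<subseteq> S \<union> Ht\<close>. This settles the
case of a proper \<open>H\<close>. If \<open>H\<close> is the whole group, all of \<open>S\<close> runs into \<open>t\<close>, so \<open>S\<close> is a right
translate by \<open>t\<close> of a progression of powers of the inverse of \<open>a\<close>.\<close>

lemma single_exit_imp_critical:
  assumes fin: "finite (carrier G)" and S: "S \<subseteq> carrier G" "S \<noteq> carrier G"
    and a: "a \<in> carrier G" "a \<noteq> \<one>" and t: "t \<in> S"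
    and exit: "\<And>u. u \<in> S \<Longrightarrow> u \<noteq> t \<Longrightarrow> a \<otimes> u \<in> S"
  shows "geometric_progression G S \<or> subgroup_critical G S"
proof -
  define H where "H = generate G {a}"
  have H: "subgroup H G" unfolding H_def by (rule generate_is_subgroup) (use a in simp)
  have Hp: "H = {a [^] i | i::nat. i \<in> UNIV}"
    unfolding H_def by (rule generate_pow_on_finite_carrier[OF fin a(1)])
  have Hc: "H \<subseteq> carrier G" using H by (rule subgroup.subset)
  have aH: "a \<in> H" unfolding H_def by (rule generate.incl) simp
  have tc: "t \<in> carrier G" using t S by blast
  have finS: "finite S" using S fin finite_subset by blast
  have pow_in: "a [^] (i::nat) \<otimes> u \<in> S" if u: "u \<in> S" and av: "\<And>j. j < i \<Longrightarrow> a [^] j \<otimes> u \<noteq> t" for i u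
    using av
  proof (induction i)
    case 0
    then show ?case using u S by auto
  next
    case (Suc i)
    have uc: "u \<in> carrier G" using u S by blast
    have "a [^] i \<otimes> u \<in> S" using Suc.IH Suc.prems by (meson less_SucI)
    moreover have "a [^] i \<otimes> u \<noteq> t" using Suc.prems by blast
    ultimately have "a \<otimes> (a [^] i \<otimes> u) \<in> S" by (rule exit)
    moreover have "a [^] Suc i \<otimes> u = a \<otimes> (a [^] i \<otimes> u)"
      using nat_pow_Suc2[OF a(1), of i] a uc by (simp add: m_assoc del: nat_pow_Suc)
    ultimately show ?case by simp
  qed
  show ?thesis
  proof (cases "H = carrier G")
    case False
    have sub: "H <#> S \<subseteq> S \<union> (H #> t)"
    proof
      fix x assume "x \<in> H <#> S"
      then obtain h u where hu: "h \<in> H" "u \<in> S" "x = h \<otimes> u" by (auto simp: set_mult_def)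
      obtain i :: nat where i: "h = a [^] i" using hu Hp by blast
      have hc: "h \<in> carrier G" and uc: "u \<in> carrier G" using hu Hc S by blast+
      show "x \<in> S \<union> (H #> t)"
      proof (cases "\<exists>j::nat. a [^] j \<otimes> u = t")
        case False
        then show ?thesis using pow_in[OF hu(2), of i] hu i by blast
      next
        case True
        then obtain j :: nat where j: "a [^] j \<otimes> u = t" by blast
        have jH: "a [^] j \<in> H" using Hp by blast
        have jc: "a [^] j \<in> carrier G" using a by simp
        have "x = (h \<otimes> inv (a [^] j)) \<otimes> t"
          unfolding j[symmetric] hu(3) using hc uc jc by (simp add: m_assoc inv_cancel_left)
        moreover have "h \<otimes> inv (a [^] j) \<in> H"
          using H hu(1) jH by (simp add: subgroup.m_closed subgroup.m_inv_closed)
        ultimately show ?thesis by (auto simp: r_coset_def)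
      qed
    qed
    have finH: "finite H" using Hc fin finite_subset by blast
    have im: "H #> t = (\<lambda>h. h \<otimes> t) ` H" by (auto simp: r_coset_def)
    have finHt: "finite (H #> t)" and cHt: "card (H #> t) \<le> card H"
      unfolding im using finH card_image_le by auto
    have "t \<in> H #> t" using subgroup.one_closed[OF H] tc by (force simp: r_coset_def)
    then have "{t} \<subseteq> S \<inter> (H #> t)" using t by blast
    then have "card {t} \<le> card (S \<inter> (H #> t))" using finS by (intro card_mono) auto
    moreover have "card S + card (H #> t) = card (S \<union> (H #> t)) + card (S \<inter> (H #> t))"
      using finS finHt by (rule card_Un_Int)
    moreover have "card (H <#> S) \<le> card (S \<union> (H #> t))"
      using sub finS finHt by (intro card_mono) auto
    ultimately have "card (H <#> S) \<le> card H + card S - 1" using cHt by simp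
    moreover have "H \<noteq> {\<one>}" using aH a by blast
    ultimately show ?thesis unfolding subgroup_critical_def using H False by blast
  next
    case True
    let ?b = "inv a"
    have pc: "a [^] (i::nat) \<in> carrier G" for i using a by simp
    have bc: "?b [^] (i::nat) \<in> carrier G" for i using a by simp
    have ex_pow: "\<exists>i::nat. x = a [^] i \<otimes> u" if "x \<in> carrier G" "u \<in> carrier G" for x u
    proof -
      have "x \<otimes> inv u \<in> H" using True that by simp
      then obtain i :: nat where "x \<otimes> inv u = a [^] i" using Hp by blast
      then have "x = a [^] i \<otimes> u" using that by (metis inv_closed inv_inv inv_solve_right pc)
      then show ?thesis by blast
    qed
    have atS: "a \<otimes> t \<notin> S"
    proof
      assume at: "a \<otimes> t \<in> S"
      have all: "a \<otimes> u \<in> S" if "u \<in> S" for u using exit[OF that] at by blast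
      have "a [^] (i::nat) \<otimes> t \<in> S" for i
      proof (induction i)
        case 0 then show ?case using t tc by simp
      next
        case (Suc i)
        have "a [^] Suc i \<otimes> t = a \<otimes> (a [^] i \<otimes> t)"
          using nat_pow_Suc2[OF a(1), of i] a tc by (simp add: m_assoc del: nat_pow_Suc)
        then show ?case using all[OF Suc] by simp
      qed
      then have "carrier G \<subseteq> S" using ex_pow[OF _ tc] by blast
      then show False using S by blast
    qed
    have reach: "\<exists>i::nat. u = ?b [^] i \<otimes> t \<and> (\<forall>j\<le>i. ?b [^] j \<otimes> t \<in> S)" if u: "u \<in> S" for u
    proof -
      have uc: "u \<in> carrier G" using u S by blast
      define i :: nat where "i = (LEAST i. t = a [^] i \<otimes> u)"
      have i: "t = a [^] i \<otimes> u" unfolding i_def using ex_pow[OF tc uc] by (rule LeastI_ex)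
      have least: "a [^] j \<otimes> u \<noteq> t" if "j < i" for j
        using not_less_Least[of j "\<lambda>i. t = a [^] i \<otimes> u"] that unfolding i_def by metis
      have step: "?b [^] j \<otimes> t = a [^] (i - j) \<otimes> u" if "j \<le> i" for j
      proof -
        have "a [^] i = a [^] j \<otimes> a [^] (i - j)" using nat_pow_mult[OF a(1), of j "i - j"] that by simp
        then have "t = a [^] j \<otimes> (a [^] (i - j) \<otimes> u)" using i uc pc by (simp add: m_assoc)
        then show ?thesis
          using nat_pow_inv[OF a(1)] inv_cancel_left(1)[of "a [^] j" "a [^] (i - j) \<otimes> u"] pc uc by simp
      qed
      have "?b [^] j \<otimes> t \<in> S" if "j \<le> i" for j
        unfolding step[OF that] by (rule pow_in[OF u]) (use least in simp)
      moreover have "u = ?b [^] i \<otimes> t" using step[of i] uc by simp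
      ultimately show ?thesis by blast
    qed
    have "\<exists>i::nat. ?b [^] i \<otimes> t \<notin> S"
    proof -
      obtain j :: nat where j: "t = a [^] j \<otimes> (a \<otimes> t)" using ex_pow[of t "a \<otimes> t"] a tc by auto
      have "?b [^] j \<otimes> t = a \<otimes> t"
        using arg_cong[OF j, of "\<lambda>x. ?b [^] j \<otimes> x"] nat_pow_inv[OF a(1)]
          inv_cancel_left(1)[of "a [^] j" "a \<otimes> t"] pc a tc by simp
      then show ?thesis using atS by metis
    qed
    \<comment> \<open>The length of the run of powers of the inverse of \<open>a\<close> that stays in \<open>S\<close> from \<open>t\<close> on.\<close>
    then obtain N :: nat where N: "?b [^] N \<otimes> t \<notin> S" "\<And>i. i < N \<Longrightarrow> ?b [^] i \<otimes> t \<in> S"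
      using exists_least_iff[of "\<lambda>i. ?b [^] i \<otimes> t \<notin> S"] by blast
    have "S = (\<lambda>i. ?b [^] i \<otimes> t) ` {..<N}"
    proof
      show "(\<lambda>i. ?b [^] i \<otimes> t) ` {..<N} \<subseteq> S" using N by blast
      show "S \<subseteq> (\<lambda>i. ?b [^] i \<otimes> t) ` {..<N}"
      proof
        fix u assume "u \<in> S"
        then obtain i :: nat where i: "u = ?b [^] i \<otimes> t" "\<forall>j\<le>i. ?b [^] j \<otimes> t \<in> S" using reach[of u] by blast
        then have "i < N" using N(1) by (meson not_le)
        then show "u \<in> (\<lambda>i. ?b [^] i \<otimes> t) ` {..<N}" using i by blast
      qed
    qed
    note SN = this
    have ne: "?b [^] i \<otimes> t \<noteq> ?b [^] j \<otimes> t" if ij: "i < j" "j < N" for i j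
    proof
      assume "?b [^] i \<otimes> t = ?b [^] j \<otimes> t"
      then have "?b [^] i = ?b [^] j" using bc tc by simp
      also have "\<dots> = ?b [^] i \<otimes> ?b [^] (j - i)" using nat_pow_mult[of ?b i "j - i"] a ij by simp
      finally have "?b [^] (j - i) = \<one>" using bc by (metis l_cancel_one')
      moreover obtain m where m: "j - i = Suc m" using ij by (metis Suc_diff_Suc)
      ultimately have "?b [^] m \<otimes> ?b = \<one>" by simp
      then have "?b [^] m = a" using a bc by (metis inv_closed inv_equality inv_inv)
      moreover have "m < N" using m ij by linarith
      ultimately show False using N(2)[of m] atS by metis
    qed
    have "inj_on (\<lambda>i. ?b [^] i \<otimes> t) {..<N}"
      by (rule linorder_inj_onI) (use ne in auto)
    then have cS: "card S = N" unfolding SN by (simp add: card_image)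
    have "S #> inv t = {?b [^] i | i::nat. i < card S}"
    proof -
      have "S #> inv t = (\<lambda>s. s \<otimes> inv t) ` S" by (auto simp: r_coset_def)
      also have "\<dots> = (\<lambda>i. ?b [^] i \<otimes> t \<otimes> inv t) ` {..<N}"
        by (subst SN) (simp add: image_image)
      also have "\<dots> = (\<lambda>i. ?b [^] i) ` {..<N}"
        using bc tc by (intro image_cong) (simp_all add: m_assoc)
      finally show ?thesis unfolding cS by auto
    qed
    then have "geometric_progression G S"
      unfolding geometric_progression_def using a tc by blast
    then show ?thesis by blast
  qed
qed

end

context isoperimetric
begin

lemma two_element_fragment_imp:
  assumes A: "fragment G S k A" "card A = 2"
  shows "geometric_progression G S \<or> subgroup_critical G S"
proof -
  obtain x y where xy: "A = {x, y}" "x \<noteq> y" using A(2) by (auto simp: card_2_iff)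
  have Ac: "A \<subseteq> carrier G" and c: "card (A <#> S) = 2 + k" "card (A <#> S) + 2 \<le> order G"
    using A by (auto simp: fragment_def)
  have xc: "x \<in> carrier G" and yc: "y \<in> carrier G" using Ac xy by auto
  define a where "a = inv y \<otimes> x"
  have a: "a \<in> carrier G" using xc yc by (simp add: a_def)
  have a1: "a \<noteq> \<one>"
  proof
    assume "a = \<one>"
    then have "y \<otimes> a = y" using yc by simp
    then show False using inv_cancel_left(2)[OF yc xc] xy(2) by (simp add: a_def)
  qed
  have finS: "finite S" using finite_sub S_subset .
  have aS: "a <# S \<subseteq> carrier G" using a S_subset by (rule l_coset_subset_G[rotated])
  have "A <#> S = y <# ((a <# S) \<union> S)"
  proof -
    have "y <# (a <# S) = x <# S"
      using lcos_m_assoc[OF S_subset yc a] inv_cancel_left(2)[OF yc xc] by (simp add: a_def)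
    moreover have "y <# ((a <# S) \<union> S) = (y <# (a <# S)) \<union> (y <# S)"
      by (auto simp: l_coset_def)
    moreover have "A <#> S = (x <# S) \<union> (y <# S)"
      unfolding xy by (auto simp: set_mult_def l_coset_def)
    ultimately show ?thesis by simp
  qed
  then have cu: "card ((a <# S) \<union> S) = 2 + k"
    using card_l_coset[OF yc, of "(a <# S) \<union> S"] aS S_subset c(1) by simp
  have "(a <# S) \<union> S = ((a <# S) - S) \<union> S" by blast
  moreover have "card (((a <# S) - S) \<union> S) = card ((a <# S) - S) + card S"
    using finS finite_sub[OF aS] by (intro card_Un_disjoint) auto
  ultimately have le: "card ((a <# S) - S) \<le> 1" using cu k_less by simp
  have fd: "finite ((a <# S) - S)" using finite_sub[OF aS] by simp
  have Sne: "S \<noteq> {}" using k_less by auto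
  have "\<exists>t\<in>S. \<forall>u\<in>S. u \<noteq> t \<longrightarrow> a \<otimes> u \<in> S"
  proof (cases "\<exists>t\<in>S. a \<otimes> t \<notin> S")
    case False
    then show ?thesis using Sne by blast
  next
    case True
    then obtain t where t: "t \<in> S" "a \<otimes> t \<notin> S" by blast
    have "u = t" if u: "u \<in> S" "a \<otimes> u \<notin> S" for u
    proof -
      have "a \<otimes> u \<in> (a <# S) - S" "a \<otimes> t \<in> (a <# S) - S" using u t by (auto simp: l_coset_def)
      then have "a \<otimes> u = a \<otimes> t" using le fd card_le_Suc0_iff_eq[OF fd] by simp
      moreover have "u \<in> carrier G" "t \<in> carrier G" using u t S_subset by blast+
      ultimately show ?thesis using a by simp
    qed
    then show ?thesis using t by blast
  qed
  then obtain t where t: "t \<in> S" "\<And>u. u \<in> S \<Longrightarrow> u \<noteq> t \<Longrightarrow> a \<otimes> u \<in> S" by blast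
  have "card S \<le> card (A <#> S)"
  proof -
    have "card S \<le> card ((a <# S) \<union> S)" using finS finite_sub[OF aS] by (intro card_mono) auto
    then show ?thesis using cu c by simp
  qed
  then have "S \<noteq> carrier G" using c(2) by (auto simp: order_def)
  then show ?thesis using single_exit_imp_critical[OF finite_carrier S_subset _ a a1 t] by blast
qed

text \<open>The four situations, for an atom \<open>A\<close> of \<open>S\<close> that is not larger than any fragment of \<open>S\<close> or of its inverse
set.\<close>

lemma critical_structure:
  assumes A: "fragment G S k A" "card A = \<alpha>"
    and le: "\<And>F. fragment G S k F \<Longrightarrow> \<alpha> \<le> card F"
    and dual_le: "\<And>F. fragment G (set_inv S) k F \<Longrightarrow> \<alpha> \<le> card F"
  shows "geometric_progression G S \<or> subgroup_critical G S \<or> subgroup_critical G (set_inv S)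
    \<or> two_coset_critical G S"
proof (cases "\<alpha> = 2")
  case True
  then show ?thesis using two_element_fragment_imp[OF A(1)] A(2) by blast
next
  case False
  interpret dual: isoperimetric G "set_inv S" k by (rule dual)
  have "3 \<le> \<alpha>" using False A by (auto simp: fragment_def)
  then interpret atomic G S k \<alpha> by unfold_locales (use le dual_le in auto)
  show ?thesis
  proof (cases "subgroup_critical G S \<or> subgroup_critical G (set_inv S)")
    case True
    then show ?thesis by blast
  next
    case False
    then have nc: "\<not> subgroup_critical G S" "\<not> subgroup_critical G (set_inv S)" by auto
    obtain B where B: "B \<in> translates G A" "B \<inter> A \<noteq> {}" "B \<noteq> A"
      using coset_fragment_imp_subgroup[OF A(1)] nc(1) by blast
    have dualnc: "\<exists>E \<in> translates G D. E \<inter> D \<noteq> {} \<and> E \<noteq> D" if "fragment G (set_inv S) k D" for D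
      using dual.coset_fragment_imp_subgroup[OF that] nc(2) by blast
    have "\<not> 2 * \<alpha> + k < order G" using large_order_contradiction[OF A _ B] dualnc by blast
    then have "order G = 2 * \<alpha> + k" using fragment_bound[OF A(1)] A(2) by linarith
    then show ?thesis using small_order_structure[OF A _ B] by blast
  qed
qed

end

section \<open>Small product sets\<close>

theorem theorem1:
  fixes G :: "('a, 'b) monoid_scheme" (structure) and S :: "'a set"
  assumes "group G" and "finite (carrier G)" and "S \<subseteq> carrier G"
    and "\<exists>T. T \<subseteq> carrier G \<and> 2 \<le> card T \<and>
           card (T <#> S) \<le> min (order G - 2) (card T + card S - 1)"
  shows "geometric_progression G S
    \<or> (\<exists>H. \<exists>\<epsilon> \<in> {1, -1 :: int}. subgroup H G \<and> H \<noteq> {\<one>} \<and> H \<noteq> carrier G \<and>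
          card (H <#> set_sign_pow G S \<epsilon>) \<le> card H + card S - 1)
    \<or> (\<exists>H. \<exists>a \<in> carrier G. \<exists>\<epsilon> \<in> {1, -1 :: int}. subgroup H G \<and>
          card ((H #> a) <#> H) = (card H)\<^sup>2 \<and>
          (let A = H \<union> (H #> a) in
             card (A <#> set_sign_pow G S \<epsilon>) = card A + card S - 1 \<and>
             card A + card S - 1 = order G - card A))"
    (is "?GP \<or> ?SUB \<or> ?TWO")
proof (cases "S = {}")
  \<comment> \<open>The empty set is the progression of length \<open>0\<close>.\<close>
  case True
  have "{a [^] i | i::nat. i < card S} = {}" for a using True by simp
  moreover have "\<one> <# S = {}" using True by (simp add: l_coset_def)
  ultimately show ?thesis
    unfolding geometric_progression_def using group.is_monoid[OF assms(1)] monoid.one_closed by metis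
next
  case False
  interpret group G by (rule assms(1))
  have finS: "finite S" using assms(2,3) finite_subset by blast
  have cS: "0 < card S" using False finS by (simp add: card_gt_0_iff)
  obtain T where T: "T \<subseteq> carrier G" "2 \<le> card T" "card (T <#> S) \<le> order G - 2"
    "card (T <#> S) \<le> card T + card S - 1" using assms(4) by auto
  have le: "card V \<le> card (V <#> S)" if V: "V \<subseteq> carrier G" for V
  proof -
    obtain s where s: "s \<in> S" using False by blast
    have "inj_on (\<lambda>v. v \<otimes> s) V" using V s assms(3) by (auto intro!: inj_onI simp: subset_iff)
    then have "card V = card ((\<lambda>v. v \<otimes> s) ` V)" by (simp add: card_image)
    also have "\<dots> \<le> card (V <#> S)"
    proof (rule card_mono)
      show "finite (V <#> S)" using set_mult_closed[OF V assms(3)] assms(2) finite_subset by blast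
      show "(\<lambda>v. v \<otimes> s) ` V \<subseteq> V <#> S" using s by (auto simp: set_mult_def)
    qed
    finally show ?thesis .
  qed
  have "card T \<le> order G - 2" using le[OF T(1)] T(3) by linarith
  then have n: "4 \<le> order G" using T(2) by linarith
  let ?adm = "\<lambda>V. V \<subseteq> carrier G \<and> 2 \<le> card V \<and> card (V <#> S) + 2 \<le> order G"
  let ?f = "\<lambda>V. card (V <#> S) - card V"
  have admT: "?adm T" using T n by auto
  then obtain M where M: "?adm M" "\<And>V. ?adm V \<Longrightarrow> ?f M \<le> ?f V"
    using ex_has_least_nat[of ?adm T ?f] by blast
  define k where "k = ?f M"
  have "k \<le> ?f T" unfolding k_def using M(2) admT by blast
  then have "k < card S" using T(4) cS le[OF T(1)] by linarith
  then interpret isoperimetric G S k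
  proof (unfold_locales)
    show "finite (carrier G)" "S \<subseteq> carrier G" using assms by auto
    fix V assume V: "V \<subseteq> carrier G" "2 \<le> card V" "card (V <#> S) + 2 \<le> order G"
    then have "k \<le> ?f V" unfolding k_def using M(2) by blast
    then show "card V + k \<le> card (V <#> S)" using le[OF V(1)] by linarith
  qed
  interpret dual: isoperimetric G "set_inv S" k by (rule dual)
  have frM: "fragment G S k M"
    unfolding fragment_def k_def using M(1) le[of M] by simp
  \<comment> \<open>A smallest fragment of either set; by duality it may be taken on the side of \<open>S\<close>.\<close>
  let ?fr = "\<lambda>F. fragment G S k F \<or> fragment G (set_inv S) k F"
  obtain A where A: "?fr A" "\<And>F. ?fr F \<Longrightarrow> card A \<le> card F"
    using ex_has_least_nat[of ?fr M card] frM by blast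
  have key: "geometric_progression G S \<or> subgroup_critical G S \<or> subgroup_critical G (set_inv S)
    \<or> two_coset_critical G S \<or> two_coset_critical G (set_inv S)"
    using A(1)
  proof
    assume "fragment G S k A"
    then show ?thesis using critical_structure[of A "card A"] A(2) by blast
  next
    assume "fragment G (set_inv S) k A"
    then have "geometric_progression G (set_inv S) \<or> subgroup_critical G (set_inv S) \<or> subgroup_critical G S
      \<or> two_coset_critical G (set_inv S)"
      using dual.critical_structure[of A "card A"] A(2) by (simp add: set_inv_set_inv[OF S_subset])
    moreover have "geometric_progression G (set_inv S) \<Longrightarrow> geometric_progression G S"
      using geometric_progression_set_inv[OF set_inv_subset[OF S_subset]]
      by (simp add: set_inv_set_inv[OF S_subset])
    ultimately show ?thesis by blast
  qed
  have signs: "set_sign_pow G S 1 = S" "set_sign_pow G S (-1) = set_inv S"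
    by (simp_all add: set_sign_pow_def)
  have cinv: "card (set_inv S) = card S" using card_set_inv[OF S_subset] .
  have sub: "?SUB \<longleftrightarrow> subgroup_critical G S \<or> subgroup_critical G (set_inv S)"
    unfolding subgroup_critical_def cinv by (simp add: signs) blast
  have two: "?TWO \<longleftrightarrow> two_coset_critical G S \<or> two_coset_critical G (set_inv S)"
    unfolding two_coset_critical_def cinv Let_def by (simp add: signs) blast
  show ?thesis unfolding sub two using key by blast
qed

end
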